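(* There exists an algorithm with the following guarantee. Given $\epsilon>0$, $\gamma\in(0,1)$, $\eta\in(0,1/2)$ and access to i.i.d. samples from an unknown distribution $\mathcal D$ on $\mathbb S^{d-1}\times\{\pm1\}$ whose labels are given by a homogeneous halfspace with margin $\gamma$ corrupted by Random Classification Noise of rate $\eta$, the algorithm draws $N=\widetilde O\big(1/(\gamma^2\epsilon^2)\big)$ samples, runs in time $\mathrm{poly}(N,d)$, and with probability at least $9/10$ outputs a hypothesis $h:\mathbb R^d\to\{\pm1\}$ satisfying $\Pr_{(\mathbf x,y)\sim\mathcal D}[h(\mathbf x)\neq y]\le \eta+\epsilon$.
   Context: $\mathbb S^{d-1}$ is the unit sphere of $\mathbb R^d$; $\mathrm{sgn}(t)=1$ if $t\ge 0$ and $-1$ otherwise. A distribution $\mathcal D$ on $\mathbb S^{d-1}\times\{\pm1\}$ is a $\gamma$-margin halfspace with Random Classification Noise (RCN) of rate $\eta$, where $\gamma\in(0,1)$ and $\eta\in(0,1/2)$, if there is an (unknown) unit vector $\mathbf w^*\in\mathbb S^{d-1}$ such that (1) $\Pr_{(\mathbf x,y)\sim\mathcal D}[|\mathbf w^*\cdot\mathbf x|<\gamma]=0$; and (2) for each point $\mathbf x$, conditionally on $\mathbf x$, the label $y$ equals $\mathrm{sgn}(\mathbf w^*\cdot\mathbf x)$ with probability $1-\eta$ and equals $-\mathrm{sgn}(\mathbf w^*\cdot\mathbf x)$ with probability $\eta$. The noise rate $\eta$ may be assumed known to the algorithm. $\widetilde O(\cdot)$ hides factors polylogarithmic in its argument.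 *)

theory Defs
  imports "HOL-Probability.Probability"
begin

section \<open>Margin halfspaces with random classification noise\<close>

text \<open>The algorithm has to be uniform in the dimension \<open>d\<close>, so \<open>d\<close> is a natural number and not a
  type: a point of \<open>d\<close>-dimensional space is an element of \<open>space (euclid d)\<close>, i.e. a function on
  \<open>{..<d}\<close> extended by \<open>undefined\<close>.\<close>

type_synonym point = "nat \<Rightarrow> real"
type_synonym example = "point \<times> real"

definition euclid :: "nat \<Rightarrow> point measure" where
  "euclid d = (\<Pi>\<^sub>M i\<in>{..<d}. borel)"

definition dotp :: "nat \<Rightarrow> point \<Rightarrow> point \<Rightarrow> real" where
  "dotp d u v = (\<Sum>i<d. u i * v i)"

definition usphere :: "nat \<Rightarrow> point measure" where
  "usphere d = restrict_space (euclid d) {x. sqrt (dotp d x x) = 1}"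

definition labels :: "real measure" where
  "labels = count_space {1, -1}"

text \<open>Unlike the library's \<^const>\<open>sgn\<close>, the value at \<open>0\<close> is \<open>1\<close>.\<close>

definition sgn_pm :: "real \<Rightarrow> real" where
  "sgn_pm t = (if t \<ge> 0 then 1 else -1)"

definition cond_prob_given_point ::
    "nat \<Rightarrow> example measure \<Rightarrow> (example \<Rightarrow> bool) \<Rightarrow> example \<Rightarrow> real" where
  "cond_prob_given_point d D P =
     real_cond_exp D (vimage_algebra (space D) fst (usphere d)) (indicator {z \<in> space D. P z})"

definition rcn_margin_halfspace :: "nat \<Rightarrow> real \<Rightarrow> real \<Rightarrow> example measure \<Rightarrow> bool" where
  "rcn_margin_halfspace d \<gamma> \<eta> D \<longleftrightarrow>
     prob_space D \<and> sets D = sets (usphere d \<Otimes>\<^sub>M labels) \<and>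
     (\<exists>w \<in> space (usphere d).
        \<P>((x, y) in D. \<bar>dotp d w x\<bar> < \<gamma>) = 0 \<and>
        (AE z in D. cond_prob_given_point d D (\<lambda>(x, y). y = sgn_pm (dotp d w x)) z = 1 - \<eta>) \<and>
        (AE z in D. cond_prob_given_point d D (\<lambda>(x, y). y = - sgn_pm (dotp d w x)) z = \<eta>))"


section \<open>Real RAM programs with access to examples\<close>

text \<open>Algorithms are programs of a real RAM with exact real arithmetic, presented as a structured
  language. The machine has natural-number registers (used for indexing and counting, with addition
  and truncated subtraction only) and finitely many unbounded arrays of reals, a program
  mentioning each array by a fixed number. There is no rounding from reals to integers and there are
  no real constants besides those computable from natural numbers. Every operation costs one unit
  of time.\<close>

datatype iexp = IConst nat | IReg nat | IAdd iexp iexp | ISub iexp iexp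

datatype rexp = RCell nat iexp | ROfNat iexp
  | RAdd rexp rexp | RSub rexp rexp | RMul rexp rexp | RDiv rexp rexp

datatype bexp = ILess iexp iexp | RLess rexp rexp | BNot bexp | BAnd bexp bexp

text \<open>\<open>Draw a e\<close> requests a fresh example and stores its coordinates and then its label in the
  \<open>d + 1\<close> consecutive cells of array \<open>a\<close> that start at index \<open>e\<close>.\<close>

datatype com = Skip
  | ISet nat iexp
  | RSet nat iexp rexp
  | Draw nat iexp
  | Seq com com
  | Cond bexp com com
  | While bexp com

record state =
  ireg :: "nat \<Rightarrow> nat"
  cell :: "nat \<Rightarrow> nat \<Rightarrow> real"
  drawn :: nat

primrec ival :: "iexp \<Rightarrow> state \<Rightarrow> nat" where
  "ival (IConst n) s = n"
| "ival (IReg r) s = ireg s r"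
| "ival (IAdd e f) s = ival e s + ival f s"
| "ival (ISub e f) s = ival e s - ival f s"

primrec rval :: "rexp \<Rightarrow> state \<Rightarrow> real" where
  "rval (RCell a e) s = cell s a (ival e s)"
| "rval (ROfNat e) s = real (ival e s)"
| "rval (RAdd e f) s = rval e s + rval f s"
| "rval (RSub e f) s = rval e s - rval f s"
| "rval (RMul e f) s = rval e s * rval f s"
| "rval (RDiv e f) s = rval e s / rval f s"

primrec bval :: "bexp \<Rightarrow> state \<Rightarrow> bool" where
  "bval (ILess e f) s \<longleftrightarrow> ival e s < ival f s"
| "bval (RLess e f) s \<longleftrightarrow> rval e s < rval f s"
| "bval (BNot b) s \<longleftrightarrow> \<not> bval b s"
| "bval (BAnd b c) s \<longleftrightarrow> bval b s \<and> bval c s"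

primrec icost :: "iexp \<Rightarrow> nat" where
  "icost (IConst n) = 1"
| "icost (IReg r) = 1"
| "icost (IAdd e f) = 1 + icost e + icost f"
| "icost (ISub e f) = 1 + icost e + icost f"

primrec rcost :: "rexp \<Rightarrow> nat" where
  "rcost (RCell a e) = 1 + icost e"
| "rcost (ROfNat e) = 1 + icost e"
| "rcost (RAdd e f) = 1 + rcost e + rcost f"
| "rcost (RSub e f) = 1 + rcost e + rcost f"
| "rcost (RMul e f) = 1 + rcost e + rcost f"
| "rcost (RDiv e f) = 1 + rcost e + rcost f"

primrec bcost :: "bexp \<Rightarrow> nat" where
  "bcost (ILess e f) = 1 + icost e + icost f"
| "bcost (RLess e f) = 1 + rcost e + rcost f"
| "bcost (BNot b) = 1 + bcost b"
| "bcost (BAnd b c) = 1 + bcost b + bcost c"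

definition store_example :: "nat \<Rightarrow> example \<Rightarrow> nat \<Rightarrow> (nat \<Rightarrow> real) \<Rightarrow> (nat \<Rightarrow> real)" where
  "store_example d z i A =
     (\<lambda>j. if i \<le> j \<and> j < i + d then fst z (j - i) else if j = i + d then snd z else A j)"

text \<open>\<open>runs d \<omega> c s t s'\<close>: started in \<open>s\<close> with \<open>\<omega> 0, \<omega> 1, \<dots>\<close> as the sequence of examples, \<open>c\<close> halts
  in \<open>s'\<close> after \<open>t\<close> units of time. The relation is deterministic; a non-halting run has no \<open>t\<close>
  and \<open>s'\<close>.\<close>

inductive runs :: "nat \<Rightarrow> (nat \<Rightarrow> example) \<Rightarrow> com \<Rightarrow> state \<Rightarrow> nat \<Rightarrow> state \<Rightarrow> bool"
  for d :: nat and \<omega> :: "nat \<Rightarrow> example" where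
  Skip: "runs d \<omega> Skip s 1 s"
| ISet: "runs d \<omega> (ISet r e) s (1 + icost e) (s\<lparr>ireg := (ireg s)(r := ival e s)\<rparr>)"
| RSet: "runs d \<omega> (RSet a e f) s (1 + icost e + rcost f)
           (s\<lparr>cell := (cell s)(a := (cell s a)(ival e s := rval f s))\<rparr>)"
| Draw: "runs d \<omega> (Draw a e) s (1 + icost e + (d + 1))
           (s\<lparr>cell := (cell s)(a := store_example d (\<omega> (drawn s)) (ival e s) (cell s a)),
              drawn := Suc (drawn s)\<rparr>)"
| Seq: "runs d \<omega> c s t s' \<Longrightarrow> runs d \<omega> c' s' t' s'' \<Longrightarrow> runs d \<omega> (Seq c c') s (t + t') s''"
| CondT: "bval b s \<Longrightarrow> runs d \<omega> c s t s' \<Longrightarrow> runs d \<omega> (Cond b c c') s (1 + bcost b + t) s'"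
| CondF: "\<not> bval b s \<Longrightarrow> runs d \<omega> c' s t s' \<Longrightarrow> runs d \<omega> (Cond b c c') s (1 + bcost b + t) s'"
| WhileF: "\<not> bval b s \<Longrightarrow> runs d \<omega> (While b c) s (1 + bcost b) s"
| WhileT: "bval b s \<Longrightarrow> runs d \<omega> c s t s' \<Longrightarrow> runs d \<omega> (While b c) s' t' s'' \<Longrightarrow>
           runs d \<omega> (While b c) s (1 + bcost b + t + t') s''"

primrec draw_free :: "com \<Rightarrow> bool" where
  "draw_free Skip \<longleftrightarrow> True"
| "draw_free (ISet r e) \<longleftrightarrow> True"
| "draw_free (RSet a e f) \<longleftrightarrow> True"
| "draw_free (Draw a e) \<longleftrightarrow> False"
| "draw_free (Seq c c') \<longleftrightarrow> draw_free c \<and> draw_free c'"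
| "draw_free (Cond b c c') \<longleftrightarrow> draw_free c \<and> draw_free c'"
| "draw_free (While b c) \<longleftrightarrow> draw_free c"


section \<open>Learning algorithms\<close>

text \<open>The learner is given \<open>d\<close> in register \<open>0\<close> and \<open>\<epsilon>, \<gamma>, \<eta>\<close> in the first cells of array \<open>0\<close>.\<close>

definition learner_input :: "nat \<Rightarrow> real \<Rightarrow> real \<Rightarrow> real \<Rightarrow> state" where
  "learner_input d \<epsilon> \<gamma> \<eta> =
     \<lparr>ireg = (\<lambda>_. 0)(0 := d),
      cell = (\<lambda>_ _. 0)(0 := (\<lambda>_. 0)(0 := \<epsilon>, 1 := \<gamma>, 2 := \<eta>)),
      drawn = 0\<rparr>"

text \<open>A real RAM outputs finitely many numbers; a function on \<open>d\<close>-dimensional space is output in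
  the form of the memory left by the learner, which a fixed second program, the evaluator,
  turns into the value of the hypothesis at any query point. The query point is placed in array \<open>1\<close>,
  the value is read off from cell \<open>0\<close> of array \<open>0\<close>.\<close>

definition load_query :: "nat \<Rightarrow> point \<Rightarrow> state \<Rightarrow> state" where
  "load_query d x s = s\<lparr>cell := (cell s)(1 := (\<lambda>j. if j < d then x j else 0))\<rparr>"

definition represents_within ::
    "nat \<Rightarrow> (nat \<Rightarrow> example) \<Rightarrow> com \<Rightarrow> state \<Rightarrow> nat \<Rightarrow> (point \<Rightarrow> real) \<Rightarrow> bool" where
  "represents_within d \<omega> E s T h \<longleftrightarrow>
     (\<forall>x \<in> space (euclid d). \<exists>t s'. runs d \<omega> E (load_query d x s) t s' \<and> t \<le> T \<and> cell s' 0 0 = h x)"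

text \<open>Non-asymptotic soft-O, with constants that are uniform over the parameter set \<open>P\<close>; the \<open>2\<close>
  keeps the logarithm away from \<open>0\<close> where \<open>g\<close> is small.\<close>

definition soft_O_on :: "'p set \<Rightarrow> ('p \<Rightarrow> real) \<Rightarrow> ('p \<Rightarrow> real) \<Rightarrow> bool" where
  "soft_O_on P f g \<longleftrightarrow> (\<exists>C::real. \<exists>k::nat. \<forall>p\<in>P. \<bar>f p\<bar> \<le> C * g p * ln (2 + g p) ^ k)"

definition params :: "(real \<times> real \<times> real \<times> nat) set" where
  "params = {(\<epsilon>, \<gamma>, \<eta>, d). 0 < \<epsilon> \<and> 0 < \<gamma> \<and> \<gamma> < 1 \<and> 0 < \<eta> \<and> \<eta> < 1/2 \<and> 1 \<le> d}"

end

theory Submission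
  imports Defs
begin

text \<open>The learner runs stochastic gradient descent on the leaky ReLU loss,
  \<open>u\<^sub>0 = 0\<close> and \<open>u\<^sub>t\<^sub>+\<^sub>1 = u\<^sub>t + (y - (1 - 2\<eta>) sgn(u\<^sub>t \<cdot> x)) x\<close>, for \<open>n = \<lceil>400 / (\<gamma>\<^sup>2 \<epsilon>\<^sup>2)\<rceil>\<close> rounds with a fresh
  example each, and outputs the majority vote of the \<open>n\<close> halfspaces \<open>sgn(u\<^sub>t \<cdot> x)\<close>. For \<open>\<epsilon> \<ge> 1\<close> nothing is
  drawn, since every hypothesis is good enough.

  Let \<open>p(u)\<close> be the probability that \<open>u\<close> and the target \<open>w\<close> classify a point differently. Since
  \<open>E[y | x] = (1 - 2\<eta>) sgn(w \<cdot> x)\<close>, in expectation a round increases \<open>u \<cdot> w\<close> by at least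
  \<open>2 (1 - 2\<eta>) \<gamma> p(u)\<close> and \<open>|u|\<^sup>2\<close> by at most 4. Hence the potential \<open>u \<cdot> w - |u|\<^sup>2 / (2a)\<close>, which never
  exceeds \<open>a / 2\<close>, grows by at least \<open>2 (1 - 2\<eta>) \<gamma> p(u) - 2 / a\<close>; for \<open>a = 2 \<surd>n\<close> this bounds the expectation
  of \<open>(1 - 2\<eta>) \<Sum>\<^sub>t p(u\<^sub>t)\<close> by \<open>\<surd>n / \<gamma>\<close>. The excess error of the majority vote is at most \<open>2 / n\<close> times
  this sum, and Markov's inequality concludes. Averaging over all rounds by the vote makes a
  validation sample unnecessary, so no logarithmic factor is lost.\<close>

section \<open>Time-bounded execution\<close>

text \<open>Total correctness with a time budget: halting is part of the claim, and the upper bound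
  \<open>T\<close> lets costs be rounded up generously instead of being computed exactly.\<close>

definition runs_within ::
    "nat \<Rightarrow> (nat \<Rightarrow> example) \<Rightarrow> com \<Rightarrow> state \<Rightarrow> nat \<Rightarrow> (state \<Rightarrow> bool) \<Rightarrow> bool" where
  "runs_within d \<omega> c s T Q \<longleftrightarrow> (\<exists>t s'. runs d \<omega> c s t s' \<and> t \<le> T \<and> Q s')"

lemma runs_within_mono:
  assumes "runs_within d \<omega> c s T P" "T \<le> U" "\<And>s'. P s' \<Longrightarrow> Q s'"
  shows "runs_within d \<omega> c s U Q"
  using assms unfolding runs_within_def by (meson le_trans)

lemma runs_within_ISet:
  assumes "Q (s\<lparr>ireg := (ireg s)(r := ival e s)\<rparr>)" "1 + icost e \<le> T"
  shows "runs_within d \<omega> (ISet r e) s T Q"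
  using assms runs.ISet unfolding runs_within_def by blast

lemma runs_within_RSet:
  assumes "Q (s\<lparr>cell := (cell s)(a := (cell s a)(ival e s := rval f s))\<rparr>)"
    and "1 + icost e + rcost f \<le> T"
  shows "runs_within d \<omega> (RSet a e f) s T Q"
  using assms runs.RSet unfolding runs_within_def by blast

lemma runs_within_Draw:
  assumes "Q (s\<lparr>cell := (cell s)(a := store_example d (\<omega> (drawn s)) (ival e s) (cell s a)),
                drawn := Suc (drawn s)\<rparr>)"
    and "1 + icost e + (d + 1) \<le> T"
  shows "runs_within d \<omega> (Draw a e) s T Q"
  using assms runs.Draw unfolding runs_within_def by blast

lemma runs_within_Seq:
  assumes "runs_within d \<omega> c s T P" "\<And>s'. P s' \<Longrightarrow> runs_within d \<omega> c' s' T' Q" "T + T' \<le> U"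
  shows "runs_within d \<omega> (Seq c c') s U Q"
proof -
  obtain t s' where 1: "runs d \<omega> c s t s'" "t \<le> T" "P s'"
    using assms(1) unfolding runs_within_def by blast
  obtain t' s'' where 2: "runs d \<omega> c' s' t' s''" "t' \<le> T'" "Q s''"
    using assms(2)[OF 1(3)] unfolding runs_within_def by blast
  have "t + t' \<le> U"
    using 1(2) 2(2) assms(3) by linarith
  then show ?thesis
    using runs.Seq[OF 1(1) 2(1)] 2(3) unfolding runs_within_def by blast
qed

lemma runs_within_Cond:
  assumes "bval b s \<Longrightarrow> runs_within d \<omega> c s T Q" "\<not> bval b s \<Longrightarrow> runs_within d \<omega> c' s T Q"
    and "1 + bcost b + T \<le> U"
  shows "runs_within d \<omega> (Cond b c c') s U Q"
proof (cases "bval b s")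
  case True
  then obtain t s' where "runs d \<omega> c s t s'" "t \<le> T" "Q s'"
    using assms(1) unfolding runs_within_def by blast
  moreover from this have "1 + bcost b + t \<le> U"
    using assms(3) by linarith
  ultimately show ?thesis
    using runs.CondT[OF True] unfolding runs_within_def by blast
next
  case False
  then obtain t s' where "runs d \<omega> c' s t s'" "t \<le> T" "Q s'"
    using assms(2) unfolding runs_within_def by blast
  moreover from this have "1 + bcost b + t \<le> U"
    using assms(3) by linarith
  ultimately show ?thesis
    using runs.CondF[OF False] unfolding runs_within_def by blast
qed

text \<open>The invariant is indexed by the round and the number \<open>n\<close> of rounds is known
  in advance, so termination needs no variant: the invariant forces the guard below \<open>n\<close>
  and refutes it at \<open>n\<close>.\<close>

lemma runs_within_While:
  assumes step: "\<And>i s. i < n \<Longrightarrow> I i s \<Longrightarrow> bval b s \<and> runs_within d \<omega> c s K (I (Suc i))"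
    and stop: "\<And>s. I n s \<Longrightarrow> \<not> bval b s"
    and init: "I 0 s"
    and time: "n * (1 + bcost b + K) + (1 + bcost b) \<le> T"
  shows "runs_within d \<omega> (While b c) s T (I n)"
proof -
  \<comment> \<open>Generalised to a loop entered at round \<open>i\<close>; the induction descends
    from \<open>n\<close>, with a budget for the remaining \<open>n - i\<close> rounds.\<close>
  have "runs_within d \<omega> (While b c) s ((n - i) * (1 + bcost b + K) + (1 + bcost b)) (I n)"
    if "i \<le> n" "I i s" for i s
    using that
  proof (induction arbitrary: s rule: inc_induct)
    case base
    then show ?case
      using runs.WhileF[OF stop] unfolding runs_within_def by fastforce
  next
    case (step i)
    then obtain t s' where 1: "bval b s" "runs d \<omega> c s t s'" "t \<le> K" "I (Suc i) s'"
      using assms(1) unfolding runs_within_def by blast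
    obtain t' s'' where 2: "runs d \<omega> (While b c) s' t' s''" "I n s''"
        "t' \<le> (n - Suc i) * (1 + bcost b + K) + (1 + bcost b)"
      using step.IH[OF 1(4)] unfolding runs_within_def by blast
    have "n - i = Suc (n - Suc i)"
      using step.hyps by simp
    then have "1 + bcost b + t + t' \<le> (n - i) * (1 + bcost b + K) + (1 + bcost b)"
      using 1(3) 2(3) by simp
    then show ?case
      using runs.WhileT[OF 1(1,2) 2(1)] 2(2) unfolding runs_within_def by blast
  qed
  from this[of 0 s] have "runs_within d \<omega> (While b c) s (n * (1 + bcost b + K) + (1 + bcost b)) (I n)"
    using init by simp
  then show ?thesis
    using time by (rule runs_within_mono)
qed

section \<open>The learner and the evaluator\<close>

text \<open>Under the noise model the coefficient of \<open>fst z\<close> has conditional mean (1 -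
  2 \<eta>) times the difference between the target's sign and that of \<open>w\<close>, hence mean
  zero where \<open>w\<close> classifies correctly. Restricting to \<open>{..<d}\<close> keeps the
  vector in \<open>space (euclid d)\<close>.\<close>

definition perceptron_step :: "nat \<Rightarrow> real \<Rightarrow> point \<Rightarrow> example \<Rightarrow> point" where
  "perceptron_step d \<eta> w z =
     (\<lambda>i\<in>{..<d}. w i + (snd z - (1 - 2 * \<eta>) * sgn_pm (dotp d w (fst z))) * fst z i)"

text \<open>The initial vector is an argument because the analysis splits off the first example and
  restarts from the updated vector.\<close>

primrec weights :: "nat \<Rightarrow> real \<Rightarrow> point \<Rightarrow> (nat \<Rightarrow> example) \<Rightarrow> nat \<Rightarrow> point" where
  "weights d \<eta> w \<omega> 0 = w"
| "weights d \<eta> w \<omega> (Suc t) = perceptron_step d \<eta> (weights d \<eta> w \<omega> t) (\<omega> t)"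

definition origin :: "nat \<Rightarrow> point" where
  "origin d = (\<lambda>i\<in>{..<d}. 0)"

definition vote :: "nat \<Rightarrow> real \<Rightarrow> nat \<Rightarrow> (nat \<Rightarrow> example) \<Rightarrow> point \<Rightarrow> real" where
  "vote d \<eta> n \<omega> x = sgn_pm (\<Sum>t<n. sgn_pm (dotp d (weights d \<eta> (origin d) \<omega> t) x))"

text \<open>The constant is 20 squared, which makes Markov's inequality give 1/10. For large
  \<epsilon> the target rate tends to 0, so even the single draw left by the ceiling would exceed
  it; hence the cutoff at 1.\<close>

definition sample_size :: "real \<Rightarrow> real \<Rightarrow> nat" where
  "sample_size \<epsilon> \<gamma> = (if \<epsilon> < 1 then nat \<lceil>400 / (\<gamma>\<^sup>2 * \<epsilon>\<^sup>2)\<rceil> else 0)"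

text \<open>Register 1 counts the rounds and register 2 holds \<open>d\<close> times that number, which is where the
  current weight vector starts in array 2; the evaluator recounts the rounds in register 4.
  The example is in array 3, and cells 3, 4, 5 of array 0 hold the inner product, the step
  length and the vote.\<close>

definition dot_prog :: "nat \<Rightarrow> com" where
  "dot_prog a =
     Seq (RSet 0 (IConst 3) (ROfNat (IConst 0)))
    (Seq (ISet 3 (IConst 0))
    (While (ILess (IReg 3) (IReg 0))
      (Seq (RSet 0 (IConst 3) (RAdd (RCell 0 (IConst 3))
             (RMul (RCell 2 (IAdd (IReg 2) (IReg 3))) (RCell a (IReg 3)))))
           (ISet 3 (IAdd (IReg 3) (IConst 1))))))"

definition step_prog :: com where
  "step_prog =
     Seq (ISet 3 (IConst 0))
    (While (ILess (IReg 3) (IReg 0))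
      (Seq (RSet 2 (IAdd (IAdd (IReg 2) (IReg 0)) (IReg 3))
             (RAdd (RCell 2 (IAdd (IReg 2) (IReg 3))) (RMul (RCell 0 (IConst 4)) (RCell 3 (IReg 3)))))
           (ISet 3 (IAdd (IReg 3) (IConst 1)))))"

definition slope :: rexp where
  "slope = RSub (ROfNat (IConst 1)) (RMul (ROfNat (IConst 2)) (RCell 0 (IConst 2)))"

definition round_prog :: com where
  "round_prog =
     Seq (Draw 3 (IConst 0))
    (Seq (dot_prog 3)
    (Seq (Cond (RLess (RCell 0 (IConst 3)) (ROfNat (IConst 0)))
           (RSet 0 (IConst 4) (RAdd (RCell 3 (IReg 0)) slope))
           (RSet 0 (IConst 4) (RSub (RCell 3 (IReg 0)) slope)))
    (Seq step_prog
    (Seq (ISet 2 (IAdd (IReg 2) (IReg 0)))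
         (ISet 1 (IAdd (IReg 1) (IConst 1)))))))"

text \<open>The machine cannot round, so the ceiling in \<open>sample_size\<close> is not computed;
  the guard compares the round count with the quotient after clearing its denominator.\<close>

definition learner :: com where
  "learner =
     While (BAnd (RLess (RCell 0 (IConst 0)) (ROfNat (IConst 1)))
                 (RLess (RMul (ROfNat (IReg 1))
                          (RMul (RMul (RCell 0 (IConst 1)) (RCell 0 (IConst 1)))
                                (RMul (RCell 0 (IConst 0)) (RCell 0 (IConst 0)))))
                        (ROfNat (IConst 400))))
       round_prog"

definition ballot_prog :: com where
  "ballot_prog =
     Seq (dot_prog 1)
    (Seq (Cond (RLess (RCell 0 (IConst 3)) (ROfNat (IConst 0)))
           (RSet 0 (IConst 5) (RSub (RCell 0 (IConst 5)) (ROfNat (IConst 1))))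
           (RSet 0 (IConst 5) (RAdd (RCell 0 (IConst 5)) (ROfNat (IConst 1)))))
    (Seq (ISet 2 (IAdd (IReg 2) (IReg 0)))
         (ISet 4 (IAdd (IReg 4) (IConst 1)))))"

text \<open>All weight vectors are still in array 2, so the vote is recomputed at the query point
  from memory alone. A tie yields 1, in agreement with \<open>sgn_pm\<close>.\<close>

definition evaluator :: com where
  "evaluator =
     Seq (ISet 2 (IConst 0))
    (Seq (ISet 4 (IConst 0))
    (Seq (RSet 0 (IConst 5) (ROfNat (IConst 0)))
    (Seq (While (ILess (IReg 4) (IReg 1)) ballot_prog)
         (Cond (RLess (RCell 0 (IConst 5)) (ROfNat (IConst 0)))
           (RSet 0 (IConst 0) (RSub (ROfNat (IConst 0)) (ROfNat (IConst 1))))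
           (RSet 0 (IConst 0) (ROfNat (IConst 1)))))))"

section \<open>Correctness and running time of the programs\<close>

lemma draw_free_evaluator: "draw_free evaluator"
  by (simp add: evaluator_def ballot_prog_def dot_prog_def)

text \<open>The accumulator is cell 3 of array 0; \<open>a \<noteq> 0\<close> keeps it apart from
  the vector being read.\<close>

lemma runs_within_dot_prog:
  assumes "a \<noteq> 0" "ireg s 0 = d" "T \<ge> 30 * d + 30"
    and Q: "Q (s\<lparr>ireg := (ireg s)(3 := d), cell := (cell s)(0 := (cell s 0)(3 :=
              dotp d (\<lambda>i. cell s 2 (ireg s 2 + i)) (cell s a)))\<rparr>)"
  shows "runs_within d \<omega> (dot_prog a) s T Q"
proof -
  \<comment> \<open>The exact state after \<open>i\<close> iterations; the loop invariant is
    equality with it.\<close>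
  define r where "r i = s\<lparr>ireg := (ireg s)(3 := i), cell := (cell s)(0 := (cell s 0)(3 :=
              dotp i (\<lambda>i. cell s 2 (ireg s 2 + i)) (cell s a)))\<rparr>" for i
  have "runs_within d \<omega> (dot_prog a) s T (\<lambda>s'. s' = r d)"
    unfolding dot_prog_def
    apply (rule runs_within_Seq[where P = "\<lambda>s'. s' = s\<lparr>cell := (cell s)(0 := (cell s 0)(3 := 0))\<rparr>"
          and T = 10 and T' = "30 * d + 20"])
      apply (rule runs_within_RSet; simp)
     apply (rule runs_within_Seq[where P = "\<lambda>s'. s' = r 0" and T = 10 and T' = "30 * d + 10"])
       apply (rule runs_within_ISet; simp add: r_def dotp_def)
      apply (rule runs_within_While[where I = "\<lambda>i s'. s' = r i" and K = 20])
    subgoal for s' s'' i s1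
      apply (rule conjI)
       apply (simp add: r_def assms(2))
      apply (rule runs_within_Seq[where T = 12 and T' = 8
            and P = "\<lambda>s2. s2 = s1\<lparr>cell := (cell s1)(0 := (cell s1 0)(3 :=
              dotp (Suc i) (\<lambda>i. cell s 2 (ireg s 2 + i)) (cell s a)))\<rparr>"])
        apply (rule runs_within_RSet)
         apply (simp_all add: r_def dotp_def assms)
      apply (rule runs_within_ISet; simp)
      done
    using assms(3) by (simp_all add: r_def assms(1,2))
  then show ?thesis
    by (rule runs_within_mono) (use Q in \<open>simp_all add: r_def\<close>)
qed

text \<open>The new vector goes to the \<open>d\<close> cells behind the current one: array 2 is
  read only below index \<open>ireg s 2 + d\<close> and written only from there on. No write
  disturbs a later read, and earlier vectors survive for the vote.\<close>

lemma runs_within_step_prog: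
  assumes "ireg s 0 = d" "T \<ge> 40 * d + 20"
    and Q: "Q (s\<lparr>ireg := (ireg s)(3 := d), cell := (cell s)(2 := (\<lambda>j.
              if ireg s 2 + d \<le> j \<and> j < ireg s 2 + d + d
              then cell s 2 (j - d) + cell s 0 4 * cell s 3 (j - (ireg s 2 + d)) else cell s 2 j))\<rparr>)"
  shows "runs_within d \<omega> step_prog s T Q"
proof -
  define r where "r i = s\<lparr>ireg := (ireg s)(3 := i), cell := (cell s)(2 := (\<lambda>j.
              if ireg s 2 + d \<le> j \<and> j < ireg s 2 + d + i
              then cell s 2 (j - d) + cell s 0 4 * cell s 3 (j - (ireg s 2 + d)) else cell s 2 j))\<rparr>" for i
  have "runs_within d \<omega> step_prog s T (\<lambda>s'. s' = r d)"
    unfolding step_prog_def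
    apply (rule runs_within_Seq[where P = "\<lambda>s'. s' = r 0" and T = 10 and T' = "40 * d + 10"])
      apply (rule runs_within_ISet; simp add: r_def fun_eq_iff)
     apply (rule runs_within_While[where I = "\<lambda>i s'. s' = r i" and K = 24])
    subgoal for s' i s1
      apply (rule conjI)
       apply (simp add: r_def assms(1))
      apply (rule runs_within_Seq[where T = 16 and T' = 8
            and P = "\<lambda>s2. s2 = (r (Suc i))\<lparr>ireg := (ireg s)(3 := i)\<rparr>"])
        apply (rule runs_within_RSet)
         apply (force simp: r_def assms fun_eq_iff)
        apply simp
       apply (rule runs_within_ISet; simp add: r_def)
      apply simp
      done
    using assms(2) by (simp_all add: r_def assms(1))
  then show ?thesis
    by (rule runs_within_mono) (use Q in \<open>simp_all add: r_def\<close>)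
qed

text \<open>Array 2 is a matrix with rows of length \<open>d\<close>. After \<open>t\<close> rounds
  it has \<open>t + 1\<close> valid rows, the last being the vector that the next round will
  use.\<close>

definition round_inv ::
    "nat \<Rightarrow> (nat \<Rightarrow> example) \<Rightarrow> real \<Rightarrow> real \<Rightarrow> real \<Rightarrow> nat \<Rightarrow> state \<Rightarrow> bool" where
  "round_inv d \<omega> \<epsilon> \<gamma> \<eta> t s \<longleftrightarrow>
     ireg s 0 = d \<and> ireg s 1 = t \<and> ireg s 2 = t * d \<and> drawn s = t \<and>
     cell s 0 0 = \<epsilon> \<and> cell s 0 1 = \<gamma> \<and> cell s 0 2 = \<eta> \<and>
     (\<forall>u\<le>t. \<forall>i<d. cell s 2 (u * d + i) = weights d \<eta> (origin d) \<omega> u i)"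

lemma dotp_cong: "(\<And>i. i < d \<Longrightarrow> u i = u' i) \<Longrightarrow> (\<And>i. i < d \<Longrightarrow> v i = v' i) \<Longrightarrow> dotp d u v = dotp d u' v'"
  by (simp add: dotp_def)

lemma runs_within_round_prog:
  assumes "round_inv d \<omega> \<epsilon> \<gamma> \<eta> t s"
  shows "runs_within d \<omega> round_prog s (100 * d + 200) (round_inv d \<omega> \<epsilon> \<gamma> \<eta> (Suc t))"
proof -
  define w where "w = weights d \<eta> (origin d) \<omega>"
  define x where "x = fst (\<omega> t)"
  define c where "c = snd (\<omega> t) - (1 - 2 * \<eta>) * sgn_pm (dotp d (w t) x)"
  have s: "ireg s 0 = d" "ireg s 1 = t" "ireg s 2 = t * d" "drawn s = t"
      "cell s 0 0 = \<epsilon>" "cell s 0 1 = \<gamma>" "cell s 0 2 = \<eta>"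
      "\<And>u i. u \<le> t \<Longrightarrow> i < d \<Longrightarrow> cell s 2 (u * d + i) = w u i"
    using assms by (auto simp: round_inv_def w_def)
  \<comment> \<open>The states \<open>s1\<close> to \<open>s6\<close> follow the program: draw,
    inner product, step length, new row, row offset, round counter.\<close>
  define s1 where "s1 = s\<lparr>cell := (cell s)(3 := store_example d (\<omega> t) 0 (cell s 3)), drawn := Suc t\<rparr>"
  define s2 where "s2 = s1\<lparr>ireg := (ireg s1)(3 := d), cell := (cell s1)(0 := (cell s1 0)(3 :=
              dotp d (\<lambda>i. cell s1 2 (ireg s1 2 + i)) (cell s1 3)))\<rparr>"
  define s3 where "s3 = s2\<lparr>cell := (cell s2)(0 := (cell s2 0)(4 := c))\<rparr>"
  define s4 where "s4 = s3\<lparr>ireg := (ireg s3)(3 := d), cell := (cell s3)(2 := (\<lambda>j.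
              if ireg s3 2 + d \<le> j \<and> j < ireg s3 2 + d + d
              then cell s3 2 (j - d) + cell s3 0 4 * cell s3 3 (j - (ireg s3 2 + d)) else cell s3 2 j))\<rparr>"
  define s5 where "s5 = s4\<lparr>ireg := (ireg s4)(2 := t * d + d)\<rparr>"
  define s6 where "s6 = s5\<lparr>ireg := (ireg s5)(1 := Suc t)\<rparr>"
  have x: "store_example d (\<omega> t) 0 A i = x i" if "i < d" for A i
    using that by (simp add: store_example_def x_def)
  have y: "store_example d (\<omega> t) 0 A d = snd (\<omega> t)" for A
    by (simp add: store_example_def)
  have "dotp d (\<lambda>i. cell s1 2 (ireg s1 2 + i)) (cell s1 3) = dotp d (w t) x"
    by (rule dotp_cong) (simp_all add: s1_def s x)
  then have dot: "cell s2 0 3 = dotp d (w t) x"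
    by (simp add: s2_def)
  \<comment> \<open>The two branches of the conditional; at inner product 0 the sign counts as 1, so
    the test is strict.\<close>
  have c: "c = (if dotp d (w t) x < 0 then snd (\<omega> t) + (1 - 2 * \<eta>) else snd (\<omega> t) - (1 - 2 * \<eta>))"
    by (simp add: c_def sgn_pm_def)
  have s4_reg: "ireg s4 0 = d" "ireg s4 1 = t" "ireg s4 2 = t * d"
    by (simp_all add: s4_def s3_def s2_def s1_def s del: One_nat_def)
  have s3_d: "ireg s3 0 = d"
    by (simp add: s3_def s2_def s1_def s)
  have inv: "round_inv d \<omega> \<epsilon> \<gamma> \<eta> (Suc t) s6"
  proof -
    have "cell s6 2 (u * d + i) = w u i" if "u \<le> Suc t" "i < d" for u i
    proof (cases "u = Suc t")
      case True
      have "cell s6 2 (d + t * d + i) = w t i + c * x i"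
        using \<open>i < d\<close> by (simp add: s6_def s5_def s4_def s3_def s2_def s1_def s x)
      also have "\<dots> = w u i"
        using \<open>i < d\<close> True by (simp add: w_def c_def x_def perceptron_step_def)
      finally show ?thesis
        using True by simp
    next
      case False
      then have "u \<le> t"
        using that by simp
      \<comment> \<open>Older rows end before the new row begins at \<open>t * d + d\<close>, so
        they are unchanged.\<close>
      moreover have "u * d + i < t * d + d"
        using mult_le_mono1[OF \<open>u \<le> t\<close>, of d] that(2) by linarith
      ultimately show ?thesis
        using that(2) by (simp add: s6_def s5_def s4_def s3_def s2_def s1_def s)
    qed
    then show ?thesis
      by (simp add: round_inv_def w_def s6_def s5_def s4_def s3_def s2_def s1_def s del: One_nat_def)
  qed
  show ?thesis
    unfolding round_prog_def
    apply (rule runs_within_Seq[where P = "\<lambda>s'. s' = s1" and T = "d + 10" and T' = "90 * d + 150"])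
      apply (rule runs_within_Draw; simp add: s1_def s)
     apply (rule runs_within_Seq[where P = "\<lambda>s'. s' = s2" and T = "30 * d + 30" and T' = "50 * d + 100"])
       apply (rule runs_within_dot_prog; simp add: s1_def s2_def s)
      apply (rule runs_within_Seq[where P = "\<lambda>s'. s' = s3" and T = "40" and T' = "50 * d + 50"])
        apply (rule runs_within_Cond[where T = 30])
          apply (rule runs_within_RSet)
           apply (simp add: dot)
           apply (simp add: s3_def s2_def s1_def c s y slope_def)
          apply (simp add: slope_def)
         apply (rule runs_within_RSet)
          apply (simp add: dot)
          apply (simp add: s3_def s2_def s1_def c s y slope_def)
         apply (simp add: slope_def)
        apply simp
       apply (rule runs_within_Seq[where P = "\<lambda>s'. s' = s4" and T = "40 * d + 20" and T' = 30])
         apply (hypsubst, rule runs_within_step_prog; simp add: s4_def s3_d)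
        apply (rule runs_within_Seq[where P = "\<lambda>s'. s' = s5" and T = 15 and T' = 15])
          apply (rule runs_within_ISet; simp add: s5_def s4_reg)
         apply (rule runs_within_ISet)
          apply (use inv in \<open>simp add: s6_def s5_def s4_reg del: One_nat_def\<close>)
         apply simp_all
    done
qed

text \<open>An integer is below a ceiling exactly when it is below the real number itself, so the
  guard stops the loop after precisely \<open>sample_size\<close> rounds.\<close>

lemma less_sample_size_iff:
  assumes "0 < \<epsilon>" "0 < \<gamma>" "\<epsilon> < 1"
  shows "t < sample_size \<epsilon> \<gamma> \<longleftrightarrow> real t * (\<gamma> * \<gamma> * (\<epsilon> * \<epsilon>)) < 400"
proof -
  have "t < sample_size \<epsilon> \<gamma> \<longleftrightarrow> int t < \<lceil>400 / (\<gamma>\<^sup>2 * \<epsilon>\<^sup>2)\<rceil>"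
    using assms(3) by (simp add: sample_size_def zless_nat_eq_int_zless)
  also have "\<dots> \<longleftrightarrow> real t < 400 / (\<gamma>\<^sup>2 * \<epsilon>\<^sup>2)"
    by (simp add: less_ceiling_iff)
  also have "\<dots> \<longleftrightarrow> real t * (\<gamma>\<^sup>2 * \<epsilon>\<^sup>2) < 400"
    using assms by (simp add: pos_less_divide_eq)
  finally show ?thesis
    by (simp add: power2_eq_square)
qed

lemma runs_within_learner:
  assumes "0 < \<epsilon>" "0 < \<gamma>"
  shows "runs_within d \<omega> learner (learner_input d \<epsilon> \<gamma> \<eta>)
           (sample_size \<epsilon> \<gamma> * (100 * d + 250) + 50) (round_inv d \<omega> \<epsilon> \<gamma> \<eta> (sample_size \<epsilon> \<gamma>))"
  unfolding learner_def
proof (rule runs_within_While[where I = "round_inv d \<omega> \<epsilon> \<gamma> \<eta>" and K = "100 * d + 200"], goal_cases)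
  case (1 t s)
  \<comment> \<open>For \<epsilon> at least 1 the sample size is 0, so there is no round to
    verify.\<close>
  have "\<epsilon> < 1"
    using 1(1) by (cases "\<epsilon> < 1") (auto simp: sample_size_def)
  then show ?case
    using 1 less_sample_size_iff[OF assms] runs_within_round_prog[OF 1(2)] by (auto simp: round_inv_def)
next
  case (2 s)
  then show ?case
    using less_sample_size_iff[OF assms, of "sample_size \<epsilon> \<gamma>"] by (auto simp: round_inv_def)
next
  case 3
  show ?case
    by (auto simp: round_inv_def learner_input_def origin_def)
next
  case 4
  then show ?case
    by (simp add: algebra_simps)
qed

lemma runs_within_evaluator:
  assumes s: "round_inv d \<omega> \<epsilon> \<gamma> \<eta> n s"
  shows "runs_within d \<omega> evaluator (load_query d x s) (n * (30 * d + 100) + 100)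
           (\<lambda>s'. cell s' 0 0 = vote d \<eta> n \<omega> x)"
proof -
  define v where "v t = (\<Sum>u<t. sgn_pm (dotp d (weights d \<eta> (origin d) \<omega> u) x))" for t
  \<comment> \<open>Loading the query overwrites array 1 only, so the rows of array 2 carry over
    from \<open>round_inv\<close>; \<open>v t\<close> is the vote among the first \<open>t\<close>
    of them.\<close>
  define I where "I t s' \<longleftrightarrow> ireg s' 0 = d \<and> ireg s' 1 = n \<and> ireg s' 2 = t * d \<and> ireg s' 4 = t \<and>
      cell s' 0 5 = v t \<and> (\<forall>i<d. cell s' 1 i = x i) \<and>
      (\<forall>u\<le>n. \<forall>i<d. cell s' 2 (u * d + i) = weights d \<eta> (origin d) \<omega> u i)"
    for t and s' :: state
  have ballot: "runs_within d \<omega> ballot_prog s' (30 * d + 90) (I (Suc t))" if "t < n" "I t s'" for t s'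
  proof -
    define s1 where "s1 = s'\<lparr>ireg := (ireg s')(3 := d), cell := (cell s')(0 := (cell s' 0)(3 :=
              dotp d (\<lambda>i. cell s' 2 (ireg s' 2 + i)) (cell s' 1)))\<rparr>"
    define s2 where "s2 = s1\<lparr>cell := (cell s1)(0 := (cell s1 0)(5 := v (Suc t)))\<rparr>"
    define s3 where "s3 = s2\<lparr>ireg := (ireg s2)(2 := t * d + d)\<rparr>"
    have "dotp d (\<lambda>i. cell s' 2 (ireg s' 2 + i)) (cell s' 1) = dotp d (weights d \<eta> (origin d) \<omega> t) x"
      by (rule dotp_cong) (use that in \<open>simp_all add: I_def\<close>)
    then have dot: "cell s1 0 3 = dotp d (weights d \<eta> (origin d) \<omega> t) x"
      by (simp add: s1_def)
    have inv: "I (Suc t) (s3\<lparr>ireg := (ireg s3)(4 := Suc t)\<rparr>)"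
      using that by (simp add: I_def s3_def s2_def s1_def)
    show ?thesis
      unfolding ballot_prog_def
      apply (rule runs_within_Seq[where P = "\<lambda>s'. s' = s1" and T = "30 * d + 30" and T' = 60])
        apply (rule runs_within_dot_prog)
           apply (use that in \<open>simp_all add: s1_def I_def\<close>)[4]
       apply (rule runs_within_Seq[where P = "\<lambda>s'. s' = s2" and T = 30 and T' = 30])
         apply (rule runs_within_Cond[where T = 20])
           apply (rule runs_within_RSet)
            apply (simp add: dot)
            apply (use that in \<open>simp add: s2_def s1_def I_def sgn_pm_def v_def\<close>)
           apply simp
          apply (rule runs_within_RSet)
           apply (simp add: dot)
           apply (use that in \<open>simp add: s2_def s1_def I_def sgn_pm_def v_def\<close>)
          apply simp
         apply simp
        apply (rule runs_within_Seq[where P = "\<lambda>s'. s' = s3" and T = 15 and T' = 15])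
          apply (rule runs_within_ISet)
           apply (use that in \<open>simp add: s3_def s2_def s1_def I_def\<close>)
          apply simp
         apply (rule runs_within_ISet)
          apply (use inv that in \<open>simp add: s3_def s2_def s1_def I_def\<close>)
         apply simp_all
      done
  qed
  define s0 where "s0 = load_query d x s"
  have s0: "ireg s0 0 = d" "ireg s0 1 = n" "\<And>i. i < d \<Longrightarrow> cell s0 1 i = x i"
      "\<And>u i. u \<le> n \<Longrightarrow> i < d \<Longrightarrow> cell s0 2 (u * d + i) = weights d \<eta> (origin d) \<omega> u i"
    using s by (auto simp: s0_def load_query_def round_inv_def)
  show ?thesis
    unfolding evaluator_def s0_def[symmetric]
    apply (rule runs_within_Seq[where P = "\<lambda>s'. s' = s0\<lparr>ireg := (ireg s0)(2 := 0)\<rparr>"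
          and T = 10 and T' = "n * (30 * d + 100) + 90"])
      apply (rule runs_within_ISet; simp)
     apply (rule runs_within_Seq[where P = "\<lambda>s'. s' = s0\<lparr>ireg := (ireg s0)(2 := 0, 4 := 0)\<rparr>"
          and T = 10 and T' = "n * (30 * d + 100) + 80"])
       apply (rule runs_within_ISet; simp)
      apply (rule runs_within_Seq[where P = "I 0" and T = 10 and T' = "n * (30 * d + 100) + 70"])
        apply (rule runs_within_RSet; simp add: I_def s0 v_def del: One_nat_def)
       apply (rule runs_within_Seq[where P = "I n" and T = "n * (30 * d + 100) + 30" and T' = 40])
         apply (rule runs_within_While[where I = I and K = "30 * d + 90"])
    subgoal
      using ballot by (auto simp: I_def)
           apply (simp add: I_def)
          apply assumption
         apply (simp add: algebra_simps)
        apply (rule runs_within_Cond[where T = 20])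
          apply (rule runs_within_RSet; simp add: I_def vote_def v_def sgn_pm_def)
         apply (rule runs_within_RSet; simp add: I_def vote_def v_def sgn_pm_def)
        apply simp_all
    done
qed

section \<open>Convergence\<close>

lemma sgn_pm_cases: "sgn_pm t = 1 \<or> sgn_pm t = -1"
  by (simp add: sgn_pm_def)

lemma abs_sgn_pm [simp]: "\<bar>sgn_pm t\<bar> = 1"
  by (simp add: sgn_pm_def)

lemma borel_measurable_sgn_pm [measurable]: "sgn_pm \<in> borel_measurable borel"
  unfolding sgn_pm_def by measurable

lemma measurable_euclid_component [measurable (raw)]:
  assumes "f \<in> M \<rightarrow>\<^sub>M euclid d" "i < d"
  shows "(\<lambda>x. f x i) \<in> borel_measurable M"
  using measurable_compose[OF assms(1)[unfolded euclid_def] measurable_component_singleton[of i]] assms(2)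
  by simp

lemma borel_measurable_dotp [measurable (raw)]:
  assumes "f \<in> M \<rightarrow>\<^sub>M euclid d" "g \<in> M \<rightarrow>\<^sub>M euclid d"
  shows "(\<lambda>x. dotp d (f x) (g x)) \<in> borel_measurable M"
  unfolding dotp_def
  by (intro borel_measurable_sum borel_measurable_times measurable_euclid_component[OF assms(1)]
      measurable_euclid_component[OF assms(2)]) auto

lemma dotp_restrict [simp]:
  "dotp d (\<lambda>i\<in>{..<d}. u i) v = dotp d u v" "dotp d v (\<lambda>i\<in>{..<d}. u i) = dotp d v u"
  by (simp_all add: dotp_def)

lemma dotp_commute: "dotp d u v = dotp d v u"
  by (simp add: dotp_def mult.commute)

lemma dotp_add_scaled_left: "dotp d (\<lambda>i. u i + c * x i) v = dotp d u v + c * dotp d x v"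
  by (simp add: dotp_def algebra_simps sum.distrib sum_distrib_left)

lemma dotp_add_scaled_self:
  "dotp d (\<lambda>i. u i + c * x i) (\<lambda>i. u i + c * x i) = dotp d u u + 2 * c * dotp d u x + c\<^sup>2 * dotp d x x"
  by (simp add: dotp_def algebra_simps sum.distrib sum_distrib_left power2_eq_square)

lemma dotp_self_nonneg: "0 \<le> dotp d u u"
  by (simp add: dotp_def sum_nonneg)

text \<open>Coordinates of a unit vector are at most 1 in absolute value. This crude bound replaces
  Cauchy-Schwarz, as only boundedness over the sphere is wanted, for integrability.\<close>

lemma abs_dotp_le:
  assumes "dotp d x x = 1"
  shows "\<bar>dotp d u x\<bar> \<le> (\<Sum>i<d. \<bar>u i\<bar>)"
proof -
  have "\<bar>x i\<bar> \<le> 1" if "i < d" for i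
  proof -
    have "x i * x i \<le> dotp d x x"
      unfolding dotp_def using that by (intro member_le_sum) auto
    then show ?thesis
      using assms by (simp flip: power2_eq_square add: abs_square_le_1)
  qed
  then have "\<bar>u i * x i\<bar> \<le> \<bar>u i\<bar>" if "i < d" for i
    using that by (simp add: abs_mult mult_left_le)
  then show ?thesis
    unfolding dotp_def by (intro order.trans[OF sum_abs] sum_mono) auto
qed

lemma origin_in_space: "origin d \<in> space (euclid d)"
  by (simp add: origin_def euclid_def space_PiM)

lemma perceptron_step_in_space: "perceptron_step d \<eta> v z \<in> space (euclid d)"
  by (simp add: perceptron_step_def euclid_def space_PiM)

lemma dotp_origin [simp]: "dotp d (origin d) v = 0" "dotp d v (origin d) = 0"
  by (simp_all add: origin_def dotp_def)

lemma dotp_perceptron_step: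
  fixes d :: nat and \<eta> :: real and z :: example
  defines "c \<equiv> \<lambda>u. snd z - (1 - 2 * \<eta>) * sgn_pm (dotp d u (fst z))"
  shows "dotp d (perceptron_step d \<eta> u z) v = dotp d u v + c u * dotp d (fst z) v"
    and "dotp d (perceptron_step d \<eta> u z) (perceptron_step d \<eta> u z) =
           dotp d u u + 2 * c u * dotp d u (fst z) + (c u)\<^sup>2 * dotp d (fst z) (fst z)"
  unfolding perceptron_step_def c_def dotp_restrict
  by (rule dotp_add_scaled_left) (rule dotp_add_scaled_self)

text \<open>Peels off the first example rather than the last, which matches the factorisation of the
  sequence space used for the expectation.\<close>

lemma weights_case_nat:
  "weights d \<eta> u (case_nat z \<omega>) (Suc t) = weights d \<eta> (perceptron_step d \<eta> u z) \<omega> t"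
  by (induction t) simp_all

text \<open>The product of \<open>s\<close> with the vote sum is \<open>n\<close> minus twice the
  number of wrong votes, and it is at most 0 when the majority is wrong, a tie giving 0.\<close>

lemma majority_error:
  fixes a :: "nat \<Rightarrow> real"
  assumes "\<And>t. t < n \<Longrightarrow> a t = 1 \<or> a t = -1" "s = 1 \<or> s = -1" "sgn_pm (\<Sum>t<n. a t) \<noteq> s"
  shows "real n \<le> 2 * (\<Sum>t<n. if a t \<noteq> s then 1 else 0)"
proof -
  have "s * (\<Sum>t<n. a t) = (\<Sum>t<n. 1 - 2 * (if a t \<noteq> s then 1 else 0))"
    unfolding sum_distrib_left
  proof (intro sum.cong refl)
    fix t assume "t \<in> {..<n}"
    then show "s * a t = 1 - 2 * (if a t \<noteq> s then 1 else 0)"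
      using assms(1)[of t] assms(2) by auto
  qed
  also have "\<dots> = real n - 2 * (\<Sum>t<n. if a t \<noteq> s then 1 else 0)"
    unfolding sum_subtractf sum_distrib_left by simp
  finally show ?thesis
    using assms(2,3) by (auto simp: sgn_pm_def split: if_splits)
qed

section \<open>Noisy labels of a fixed target halfspace\<close>

locale rcn_halfspace = prob_space D for D :: "example measure" +
  fixes d :: nat and \<gamma> \<eta> :: real and w :: point
  assumes sets_D: "sets D = sets (usphere d \<Otimes>\<^sub>M labels)"
    and w_usphere: "w \<in> space (usphere d)"
    and margin: "\<P>((x, y) in D. \<bar>dotp d w x\<bar> < \<gamma>) = 0"
    and label_eq: "AE z in D. cond_prob_given_point d D (\<lambda>(x, y). y = sgn_pm (dotp d w x)) z = 1 - \<eta>"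
    and label_neq: "AE z in D. cond_prob_given_point d D (\<lambda>(x, y). y = - sgn_pm (dotp d w x)) z = \<eta>"
    and \<gamma>_pos: "0 < \<gamma>" and \<eta>_pos: "0 < \<eta>" and \<eta>_less: "\<eta> < 1 / 2"
begin

sublocale seq: sequence_space D ..

abbreviation S where "S \<equiv> \<Pi>\<^sub>M i\<in>(UNIV :: nat set). D"

lemma space_D: "space D = space (usphere d) \<times> {1, -1}"
  using sets_eq_imp_space_eq[OF sets_D] by (simp add: space_pair_measure labels_def)

lemma space_usphere: "x \<in> space (usphere d) \<longleftrightarrow> x \<in> space (euclid d) \<and> dotp d x x = 1"
  by (auto simp: usphere_def space_restrict_space)

lemma measurable_fst_usphere: "fst \<in> D \<rightarrow>\<^sub>M usphere d"
  unfolding measurable_cong_sets[OF sets_D refl] by measurable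

lemma usphere_euclid: "f \<in> usphere d \<rightarrow>\<^sub>M N" if "f \<in> euclid d \<rightarrow>\<^sub>M N"
  unfolding usphere_def using that by (rule measurable_restrict_space1)

lemma measurable_fst_D [measurable]: "fst \<in> D \<rightarrow>\<^sub>M euclid d"
  using measurable_compose[OF measurable_fst_usphere usphere_euclid[OF measurable_ident]] by simp

lemma measurable_snd_D [measurable]: "snd \<in> borel_measurable D"
proof -
  have "snd \<in> D \<rightarrow>\<^sub>M labels"
    unfolding measurable_cong_sets[OF sets_D refl] by measurable
  moreover have "(\<lambda>y. y) \<in> labels \<rightarrow>\<^sub>M (borel :: real measure)"
    by (simp add: labels_def)
  ultimately show ?thesis
    using measurable_compose by fastforce
qed

lemma w_euclid [measurable]: "w \<in> space (euclid d)"
  using w_usphere by (simp add: space_usphere)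

lemma D_cases:
  assumes "z \<in> space D"
  shows "snd z = 1 \<or> snd z = -1" "\<bar>snd z\<bar> = 1" "dotp d (fst z) (fst z) = 1" "fst z \<in> space (euclid d)"
  using assms by (auto simp: space_D space_usphere)

lemma measurable_perceptron_step [measurable (raw)]:
  assumes [measurable]: "f \<in> N \<rightarrow>\<^sub>M euclid d" "g \<in> N \<rightarrow>\<^sub>M D"
  shows "(\<lambda>x. perceptron_step d \<eta> (f x) (g x)) \<in> N \<rightarrow>\<^sub>M euclid d"
proof -
  have [measurable]: "(\<lambda>x. fst (g x)) \<in> N \<rightarrow>\<^sub>M euclid d"
    by measurable
  have "(\<lambda>x. f x i + (snd (g x) - (1 - 2 * \<eta>) * sgn_pm (dotp d (f x) (fst (g x)))) * fst (g x) i)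
          \<in> borel_measurable N" if "i < d" for i
    using that by measurable
  then show ?thesis
    unfolding perceptron_step_def euclid_def by (intro measurable_restrict) auto
qed

lemma measurable_weights [measurable (raw)]:
  assumes [measurable]: "f \<in> N \<rightarrow>\<^sub>M euclid d" "g \<in> N \<rightarrow>\<^sub>M S"
  shows "(\<lambda>x. weights d \<eta> (f x) (g x) t) \<in> N \<rightarrow>\<^sub>M euclid d"
  by (induction t) (simp_all, measurable)

text \<open>This is where the noise condition enters: given the point, the label is the target's
  sign with probability 1 - \<eta> and its negative with probability \<eta>, so its conditional mean
  is (1 - 2 \<eta>) times that sign.\<close>

lemma label_correlation:
  assumes [measurable]: "f \<in> borel_measurable (euclid d)"
    and int: "integrable D (\<lambda>z. f (fst z))"
  shows "(\<integral>z. snd z * f (fst z) \<partial>D) = (1 - 2 * \<eta>) * (\<integral>z. sgn_pm (dotp d w (fst z)) * f (fst z) \<partial>D)"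
proof -
  define F where "F = vimage_algebra (space D) fst (usphere d)"
  define k where "k z = sgn_pm (dotp d w (fst z)) * f (fst z)" for z :: example
  define P where "P = (\<lambda>(x, y). y = sgn_pm (dotp d w x))"
  define Q where "Q = (\<lambda>(x, y). y = - sgn_pm (dotp d w x))"
  have [measurable]: "Measurable.pred D P" "Measurable.pred D Q"
    unfolding P_def Q_def split_beta by measurable
  have "subalgebra D F"
    unfolding subalgebra_def F_def using measurable_fst_usphere by (simp add: measurable_iff_sets)
  then interpret finite_measure_subalgebra D F
    by unfold_locales
  have "fst \<in> F \<rightarrow>\<^sub>M usphere d"
    unfolding F_def by (rule measurable_vimage_algebra1) (auto simp: space_D)
  then have "(\<lambda>z. (\<lambda>x. sgn_pm (dotp d w x) * f x) (fst z)) \<in> borel_measurable F"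
    by (rule measurable_compose) (rule usphere_euclid, measurable)
  then have kF [measurable]: "k \<in> borel_measurable F"
    by (simp add: k_def[abs_def])
  have [measurable]: "k \<in> borel_measurable D"
    unfolding k_def by measurable
  have k_int: "integrable D k"
    using int by (rule Bochner_Integration.integrable_bound) (auto simp: k_def abs_mult)
  have int_ind: "integrable D (\<lambda>z. k z * indicator {z \<in> space D. R z} z)"
    if [measurable]: "Measurable.pred D R" for R
    using k_int by (rule Bochner_Integration.integrable_bound) (auto simp: indicator_def)
  \<comment> \<open>\<open>k\<close> depends on the point alone, so it is measurable for the
    conditioning algebra \<open>F\<close> and the indicator may be replaced by its conditional
    probability.\<close>
  have cond: "(\<integral>z. k z * indicator {z \<in> space D. R z} z \<partial>D) = q * (\<integral>z. k z \<partial>D)"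
    if [measurable]: "Measurable.pred D R" and q: "AE z in D. cond_prob_given_point d D R z = q" for R q
  proof -
    have "(\<integral>z. k z * indicator {z \<in> space D. R z} z \<partial>D) =
          (\<integral>z. k z * real_cond_exp D F (indicator {z \<in> space D. R z}) z \<partial>D)"
      using int_ind by (intro real_cond_exp_intg(2)[symmetric]) auto
    also have "\<dots> = (\<integral>z. q * k z \<partial>D)"
      using q by (intro integral_cong_AE) (auto simp: cond_prob_given_point_def F_def)
    finally show ?thesis
      by simp
  qed
  have "(\<integral>z. snd z * f (fst z) \<partial>D) =
        (\<integral>z. k z * indicator {z \<in> space D. P z} z - k z * indicator {z \<in> space D. Q z} z \<partial>D)"
  proof (rule Bochner_Integration.integral_cong)
    fix z assume z: "z \<in> space D"
    show "snd z * f (fst z) =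
        k z * indicator {z \<in> space D. P z} z - k z * indicator {z \<in> space D. Q z} z"
      using D_cases(1)[OF z] sgn_pm_cases[of "dotp d w (fst z)"] z
      by (auto simp: k_def P_def Q_def split_beta indicator_def)
  qed simp
  also have "\<dots> = (1 - \<eta>) * (\<integral>z. k z \<partial>D) - \<eta> * (\<integral>z. k z \<partial>D)"
    using int_ind cond[of P] cond[of Q] label_eq label_neq by (simp add: P_def Q_def)
  finally show ?thesis
    by (simp add: k_def algebra_simps)
qed

text \<open>Written as an integral so that linearity and monotonicity apply directly to averages of
  hypotheses.\<close>

definition disagreement :: "(point \<Rightarrow> real) \<Rightarrow> real" where
  "disagreement h = (\<integral>z. (if h (fst z) \<noteq> sgn_pm (dotp d w (fst z)) then 1 else 0) \<partial>D)"

lemma disagreement_nonneg: "0 \<le> disagreement h"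
  unfolding disagreement_def by (rule integral_nonneg_AE) auto

text \<open>For signs, the indicator of \<open>h x \<noteq> y\<close> is (1 - y h(x)) / 2.
  \<open>label_correlation\<close> with \<open>f = h\<close> replaces the label by the target's
  sign, and the same identity turns the result back into a disagreement.\<close>

lemma misclassification_eq:
  assumes [measurable]: "h \<in> borel_measurable (euclid d)" and h: "\<And>x. h x = 1 \<or> h x = -1"
  shows "\<P>((x, y) in D. h x \<noteq> y) = \<eta> + (1 - 2 * \<eta>) * disagreement h"
proof -
  have h_bound: "\<bar>h x\<bar> \<le> 1" for x
    using h[of x] by auto
  have int_yh: "integrable D (\<lambda>z. snd z * h (fst z))"
    by (intro integrable_const_bound[where B = 1])
      (use h_bound in \<open>auto intro!: AE_I2 simp: abs_mult D_cases(2)\<close>)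
  have int_dis: "integrable D (\<lambda>z. if h (fst z) \<noteq> sgn_pm (dotp d w (fst z)) then 1 else 0 :: real)"
    by (intro integrable_const_bound[where B = 1]) auto
  have "\<P>((x, y) in D. h x \<noteq> y) = (\<integral>z. indicator {z \<in> space D. case z of (x, y) \<Rightarrow> h x \<noteq> y} z \<partial>D)"
    unfolding split_beta by simp
  also have "\<dots> = (\<integral>z. 1 / 2 - snd z * h (fst z) / 2 \<partial>D)"
  proof (rule Bochner_Integration.integral_cong)
    fix z assume "z \<in> space D"
    then show "indicator {z \<in> space D. case z of (x, y) \<Rightarrow> h x \<noteq> y} z = 1 / 2 - snd z * h (fst z) / 2"
      using D_cases(1)[of z] h[of "fst z"] by (auto simp: split_beta indicator_def)
  qed simp
  also have "\<dots> = 1 / 2 - (\<integral>z. snd z * h (fst z) \<partial>D) / 2"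
    using int_yh by (simp add: prob_space)
  also have "(\<integral>z. snd z * h (fst z) \<partial>D) =
      (1 - 2 * \<eta>) * (\<integral>z. sgn_pm (dotp d w (fst z)) * h (fst z) \<partial>D)"
    using h_bound by (intro label_correlation integrable_const_bound[where B = 1]) auto
  also have "(\<integral>z. sgn_pm (dotp d w (fst z)) * h (fst z) \<partial>D) =
      (\<integral>z. 1 - 2 * (if h (fst z) \<noteq> sgn_pm (dotp d w (fst z)) then 1 else 0) \<partial>D)"
  proof (rule Bochner_Integration.integral_cong)
    fix z
    show "sgn_pm (dotp d w (fst z)) * h (fst z) =
        1 - 2 * (if h (fst z) \<noteq> sgn_pm (dotp d w (fst z)) then 1 else 0)"
      using sgn_pm_cases[of "dotp d w (fst z)"] h[of "fst z"] by auto
  qed simp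
  also have "\<dots> = 1 - 2 * disagreement h"
    unfolding disagreement_def using int_dis by (simp add: prob_space del: if_not_P)
  finally show ?thesis
    by (simp add: field_simps)
qed

section \<open>Drift of the potential in one round\<close>

abbreviation halfspace :: "point \<Rightarrow> point \<Rightarrow> real" where
  "halfspace u x \<equiv> sgn_pm (dotp d u x)"

definition potential :: "real \<Rightarrow> point \<Rightarrow> real" where
  "potential a u = dotp d u w - dotp d u u / (2 * a)"

text \<open>Expand |u - a w|^2 \<ge> 0 using |w| = 1.\<close>

lemma potential_le:
  assumes "a > 0"
  shows "potential a u \<le> a / 2"
proof -
  have "0 \<le> dotp d u u - 2 * a * dotp d u w + a\<^sup>2"
    using dotp_self_nonneg[of d "\<lambda>i. u i + (- a) * w i"] w_usphere
    unfolding dotp_add_scaled_self by (simp add: space_usphere)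
  then have "2 * a * dotp d u w - dotp d u u \<le> a * a"
    by (simp add: power2_eq_square)
  then show ?thesis
    using assms by (simp add: potential_def field_simps)
qed

lemma AE_margin: "AE z in D. \<gamma> \<le> \<bar>dotp d w (fst z)\<bar>"
proof (rule AE_I)
  show "{z \<in> space D. \<not> \<gamma> \<le> \<bar>dotp d w (fst z)\<bar>} \<subseteq> {z \<in> space D. \<bar>dotp d w (fst z)\<bar> < \<gamma>}"
    by auto
  show "emeasure D {z \<in> space D. \<bar>dotp d w (fst z)\<bar> < \<gamma>} = 0"
    using margin by (simp add: emeasure_eq_measure split_def)
qed measurable

text \<open>A step of length \<open>c\<close> along \<open>x\<close> changes the potential by c f(x)
  - c^2 / (2a). By \<open>label_correlation\<close> the first term has mean (1 - 2 \<eta>)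
  E[(sgn(w.x) - sgn(u.x)) f(x)], to which only points of disagreement contribute, each at least 2
  \<gamma>.\<close>

lemma potential_drift:
  assumes a: "a > 0" and [measurable]: "u \<in> space (euclid d)"
  shows "integrable D (\<lambda>z. potential a (perceptron_step d \<eta> u z))" (is "integrable D ?\<Psi>")
    and "potential a u + 2 * (1 - 2 * \<eta>) * \<gamma> * disagreement (halfspace u) - 2 / a
           \<le> (\<integral>z. potential a (perceptron_step d \<eta> u z) \<partial>D)"
proof -
  define \<beta> where "\<beta> = 1 - 2 * \<eta>"
  have \<beta>: "0 < \<beta>" "\<beta> < 1"
    using \<eta>_pos \<eta>_less by (auto simp: \<beta>_def)
  define c where "c z = snd z - \<beta> * halfspace u (fst z)" for z :: example
  \<comment> \<open>The directional derivative of the potential at \<open>u\<close> along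
    \<open>x\<close>.\<close>
  define f where "f x = dotp d w x - dotp d u x / a" for x
  define dis where "dis z = (if halfspace u (fst z) \<noteq> halfspace w (fst z) then 1 else 0 :: real)"
    for z :: example
  define B where "B = (\<Sum>i<d. \<bar>w i\<bar>) + (\<Sum>i<d. \<bar>u i\<bar>) / a"
  have [measurable]: "f \<in> borel_measurable (euclid d)"
    unfolding f_def by measurable
  have [measurable]: "c \<in> borel_measurable D"
    unfolding c_def by measurable
  have [measurable]: "dis \<in> borel_measurable D"
    unfolding dis_def by measurable
  have f_bound: "\<bar>f (fst z)\<bar> \<le> B" if "z \<in> space D" for z
  proof -
    have "\<bar>f (fst z)\<bar> \<le> \<bar>dotp d w (fst z)\<bar> + \<bar>dotp d u (fst z)\<bar> / a"
      using abs_triangle_ineq4[of "dotp d w (fst z)" "dotp d u (fst z) / a"] a by (simp add: f_def)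
    also have "\<dots> \<le> B"
      unfolding B_def using abs_dotp_le[OF D_cases(3)[OF that]] a
      by (intro add_mono divide_right_mono) auto
    finally show ?thesis .
  qed
  have c_bound: "\<bar>c z\<bar> \<le> 2" if "z \<in> space D" for z
    using D_cases(1)[OF that] \<beta> sgn_pm_cases[of "dotp d u (fst z)"] by (auto simp: c_def)
  have step: "?\<Psi> z = potential a u + (c z * f (fst z) - (c z)\<^sup>2 / (2 * a))" if "z \<in> space D" for z
    unfolding potential_def dotp_perceptron_step(2) dotp_perceptron_step(1)[where v = w]
    using a by (simp add: c_def f_def \<beta>_def dotp_commute[of d "fst z" w] D_cases(3)[OF that] field_simps)
  have int_f: "integrable D (\<lambda>z. f (fst z))"
    using f_bound by (intro integrable_const_bound[where B = B]) auto
  have int_sf: "integrable D (\<lambda>z. halfspace v (fst z) * f (fst z))"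
    if [measurable]: "v \<in> space (euclid d)" for v
    using f_bound by (intro integrable_const_bound[where B = B]) (auto simp: abs_mult)
  have int_yf: "integrable D (\<lambda>z. snd z * f (fst z))"
    using int_f by (rule Bochner_Integration.integrable_bound)
      (auto intro!: AE_I2 simp: abs_mult D_cases(2))
  have int_cf: "integrable D (\<lambda>z. c z * f (fst z))"
    unfolding c_def left_diff_distrib mult.assoc
    by (intro Bochner_Integration.integrable_diff int_yf integrable_mult_right int_sf assms(2))
  have int_c2: "integrable D (\<lambda>z. (c z)\<^sup>2 / (2 * a))"
  proof -
    have "integrable D (\<lambda>z. (c z)\<^sup>2)"
      using c_bound abs_le_square_iff[of _ "2 :: real"]
      by (intro integrable_const_bound[where B = 4]) fastforce+
    then show ?thesis
      by simp
  qed
  show "integrable D ?\<Psi>"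
    using int_cf int_c2 by (subst Bochner_Integration.integrable_cong[OF refl step]) auto
  have int_dis: "integrable D dis"
    by (intro integrable_const_bound[where B = 1]) (auto simp: dis_def)
  have "2 * \<gamma> * disagreement (halfspace u) = (\<integral>z. 2 * \<gamma> * dis z \<partial>D)"
    by (simp add: disagreement_def dis_def[abs_def])
  also have "\<dots> \<le> (\<integral>z. halfspace w (fst z) * f (fst z) - halfspace u (fst z) * f (fst z) \<partial>D)"
  proof (rule integral_mono_AE)
    show "AE z in D. 2 * \<gamma> * dis z \<le> halfspace w (fst z) * f (fst z) - halfspace u (fst z) * f (fst z)"
      using AE_margin
    proof eventually_elim
      case (elim z)
      show ?case
      proof (cases "halfspace u (fst z) = halfspace w (fst z)")
        case False
        \<comment> \<open>Opposite signs make both parts of \<open>f\<close> pull in the same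
          direction; the margin bounds the first from below and the second is dropped.\<close>
        then have "halfspace w (fst z) * f (fst z) - halfspace u (fst z) * f (fst z) =
            2 * \<bar>dotp d w (fst z)\<bar> + 2 * \<bar>dotp d u (fst z)\<bar> / a"
          using a by (auto simp: f_def sgn_pm_def field_simps split: if_splits)
        moreover have "0 \<le> 2 * \<bar>dotp d u (fst z)\<bar> / a"
          using a by simp
        ultimately show ?thesis
          using False elim by (simp add: dis_def)
      qed (simp add: dis_def)
    qed
  qed (use int_dis int_sf[OF w_euclid] int_sf[OF assms(2)] in auto)
  also have "\<dots> = (\<integral>z. halfspace w (fst z) * f (fst z) \<partial>D) - (\<integral>z. halfspace u (fst z) * f (fst z) \<partial>D)"
    by (intro Bochner_Integration.integral_diff int_sf w_euclid assms(2))
  finally have "\<beta> * (2 * \<gamma> * disagreement (halfspace u)) \<le>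
      \<beta> * ((\<integral>z. halfspace w (fst z) * f (fst z) \<partial>D) - (\<integral>z. halfspace u (fst z) * f (fst z) \<partial>D))"
    using \<beta> by (intro mult_left_mono) auto
  also have "\<dots> = (\<integral>z. snd z * f (fst z) \<partial>D) - (\<integral>z. \<beta> * (halfspace u (fst z) * f (fst z)) \<partial>D)"
    using label_correlation[OF _ int_f] by (simp add: \<beta>_def right_diff_distrib)
  also have "\<dots> = (\<integral>z. snd z * f (fst z) - \<beta> * (halfspace u (fst z) * f (fst z)) \<partial>D)"
    by (intro Bochner_Integration.integral_diff[symmetric] integrable_mult_right int_yf int_sf assms(2))
  also have "\<dots> = (\<integral>z. c z * f (fst z) \<partial>D)"
    by (simp add: c_def algebra_simps)
  finally have cf: "2 * \<beta> * \<gamma> * disagreement (halfspace u) \<le> (\<integral>z. c z * f (fst z) \<partial>D)"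
    by (simp add: algebra_simps)
  \<comment> \<open>The quadratic loss is at most 4 / (2a) because the step length is at most
    2.\<close>
  have "(\<integral>z. (c z)\<^sup>2 / (2 * a) \<partial>D) \<le> (\<integral>z. 4 / (2 * a) \<partial>D)"
    using int_c2 c_bound abs_le_square_iff[of _ "2 :: real"] a
    by (intro integral_mono) (fastforce intro!: divide_right_mono)+
  then have c2: "(\<integral>z. (c z)\<^sup>2 / (2 * a) \<partial>D) \<le> 2 / a"
    by (simp add: prob_space)
  have "(\<integral>z. ?\<Psi> z \<partial>D) = (\<integral>z. potential a u + (c z * f (fst z) - (c z)\<^sup>2 / (2 * a)) \<partial>D)"
    using step by (intro Bochner_Integration.integral_cong) auto
  also have "\<dots> = potential a u + ((\<integral>z. c z * f (fst z) \<partial>D) - (\<integral>z. (c z)\<^sup>2 / (2 * a) \<partial>D))"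
    using int_cf int_c2 by (simp add: prob_space)
  finally show "potential a u + 2 * (1 - 2 * \<eta>) * \<gamma> * disagreement (halfspace u) - 2 / a
           \<le> (\<integral>z. ?\<Psi> z \<partial>D)"
    using cf c2 by (simp add: \<beta>_def)
qed

section \<open>Expected total disagreement over all rounds\<close>

lemma measurable_disagreement [measurable (raw)]:
  assumes [measurable]: "(\<lambda>(x, y). h x y) \<in> borel_measurable (N \<Otimes>\<^sub>M euclid d)"
  shows "(\<lambda>x. disagreement (h x)) \<in> borel_measurable N"
proof -
  have "(\<lambda>p. (\<lambda>(x, y). h x y) (fst p, fst (snd p))) \<in> borel_measurable (N \<Otimes>\<^sub>M D)"
    by measurable
  then have [measurable]: "(\<lambda>p. h (fst p) (fst (snd p))) \<in> borel_measurable (N \<Otimes>\<^sub>M D)"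
    by simp
  show ?thesis
    unfolding disagreement_def by measurable
qed

text \<open>Induction on the number of rounds with an arbitrary start \<open>u\<close>: the first
  example is split off and the hypothesis applied to the updated vector, so the drifts telescope.
  Nonnegative integrals spare integrability proofs for the sums.\<close>

lemma expected_disagreement:
  assumes a: "a > 0" and "u \<in> space (euclid d)"
  shows "(\<integral>\<^sup>+\<omega>. (\<Sum>t<n. ennreal (2 * (1 - 2 * \<eta>) * \<gamma> * disagreement (halfspace (weights d \<eta> u \<omega> t)))) \<partial>S)
           \<le> ennreal (a / 2 + 2 * real n / a - potential a u)"
  using assms(2)
proof (induction n arbitrary: u)
  case 0
  then show ?case
    by simp
next
  case (Suc n)
  note [measurable] = Suc.prems
  define \<phi> where "\<phi> v = ennreal (2 * (1 - 2 * \<eta>) * \<gamma> * disagreement (halfspace v))" for v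
  define \<Phi> where "\<Phi> n v \<omega> = (\<Sum>t<n. \<phi> (weights d \<eta> v \<omega> t))" for n v \<omega>
  \<comment> \<open>The budget left for \<open>m\<close> rounds from \<open>v\<close>. Its
    nonnegativity matters because \<open>ennreal\<close> would truncate negative values.\<close>
  define R where "R m v = a / 2 + 2 * real m / a - potential a v" for m v
  have R_nonneg: "0 \<le> R m v" for m v
    using potential_le[OF a, of v] a by (simp add: R_def add_increasing2)
  have [measurable]: "(\<lambda>x. \<phi> (f x)) \<in> borel_measurable N" if [measurable]: "f \<in> N \<rightarrow>\<^sub>M euclid d" for f and N :: "'b measure"
    unfolding \<phi>_def by measurable
  have [measurable]: "\<Phi> (Suc n) u \<in> borel_measurable S"
    unfolding \<Phi>_def \<phi>_def by measurable
  \<comment> \<open>The sequence space is the law of one example prepended to an independent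
    sequence.\<close>
  have "(\<integral>\<^sup>+\<omega>. \<Phi> (Suc n) u \<omega> \<partial>S) = (\<integral>\<^sup>+\<omega>. \<Phi> (Suc n) u \<omega> \<partial>distr (D \<Otimes>\<^sub>M S) S (\<lambda>(z, \<omega>). case_nat z \<omega>))"
    by (simp add: seq.PiM_iter)
  also have "\<dots> = (\<integral>\<^sup>+p. \<Phi> (Suc n) u (case_nat (fst p) (snd p)) \<partial>(D \<Otimes>\<^sub>M S))"
    by (subst nn_integral_distr) (auto simp: split_beta)
  also have "\<dots> = (\<integral>\<^sup>+p. \<phi> u + \<Phi> n (perceptron_step d \<eta> u (fst p)) (snd p) \<partial>(D \<Otimes>\<^sub>M S))"
    unfolding \<Phi>_def by (simp add: sum.lessThan_Suc_shift weights_case_nat del: sum.lessThan_Suc weights.simps(2))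
  also have "\<dots> = (\<integral>\<^sup>+z. \<integral>\<^sup>+\<omega>. \<phi> u + \<Phi> n (perceptron_step d \<eta> u z) \<omega> \<partial>S \<partial>D)"
  proof -
    have "(\<lambda>p. \<phi> u + \<Phi> n (perceptron_step d \<eta> u (fst p)) (snd p)) \<in> borel_measurable (D \<Otimes>\<^sub>M S)"
      unfolding \<Phi>_def by measurable
    then show ?thesis
      by (rule seq.P.nn_integral_fst[symmetric, THEN trans]) (simp only: fst_conv snd_conv)
  qed
  also have "\<dots> \<le> (\<integral>\<^sup>+z. \<phi> u + ennreal (R n (perceptron_step d \<eta> u z)) \<partial>D)"
  proof (rule nn_integral_mono)
    fix z assume [measurable]: "z \<in> space D"
    have [measurable]: "\<Phi> n (perceptron_step d \<eta> u z) \<in> borel_measurable S"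
      unfolding \<Phi>_def using perceptron_step_in_space by measurable
    have "(\<integral>\<^sup>+\<omega>. \<phi> u + \<Phi> n (perceptron_step d \<eta> u z) \<omega> \<partial>S) =
        \<phi> u + (\<integral>\<^sup>+\<omega>. \<Phi> n (perceptron_step d \<eta> u z) \<omega> \<partial>S)"
      by (subst nn_integral_add) (auto simp: seq.P.emeasure_space_1)
    also have "\<dots> \<le> \<phi> u + ennreal (R n (perceptron_step d \<eta> u z))"
      using Suc.IH[OF perceptron_step_in_space, of \<eta> u z] by (intro add_left_mono) (simp add: \<Phi>_def \<phi>_def R_def)
    finally show "(\<integral>\<^sup>+\<omega>. \<phi> u + \<Phi> n (perceptron_step d \<eta> u z) \<omega> \<partial>S) \<le>
        \<phi> u + ennreal (R n (perceptron_step d \<eta> u z))" .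
  qed
  also have "\<dots> = \<phi> u + (\<integral>\<^sup>+z. ennreal (R n (perceptron_step d \<eta> u z)) \<partial>D)"
    using potential_drift(1)[OF a Suc.prems]
    by (subst nn_integral_add) (auto simp: R_def emeasure_space_1)
  also have "(\<integral>\<^sup>+z. ennreal (R n (perceptron_step d \<eta> u z)) \<partial>D) =
      ennreal (\<integral>z. R n (perceptron_step d \<eta> u z) \<partial>D)"
    using potential_drift(1)[OF a Suc.prems] R_nonneg
    by (intro nn_integral_eq_integral) (auto simp: R_def)
  also have "\<phi> u + \<dots> = ennreal (2 * (1 - 2 * \<eta>) * \<gamma> * disagreement (halfspace u) + (\<integral>z. R n (perceptron_step d \<eta> u z) \<partial>D))"
    unfolding \<phi>_def using R_nonneg \<eta>_less \<gamma>_pos disagreement_nonneg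
    by (intro ennreal_plus[symmetric] integral_nonneg_AE mult_nonneg_nonneg) auto
  \<comment> \<open>The drift bound says that the disagreement paid now plus the expected later
    budget stays within the present one; the extra \<open>2 / a\<close> is the new round's
    share.\<close>
  also have "\<dots> \<le> ennreal (R (Suc n) u)"
  proof (rule ennreal_leI)
    have "(\<integral>z. R n (perceptron_step d \<eta> u z) \<partial>D) =
        a / 2 + 2 * real n / a - (\<integral>z. potential a (perceptron_step d \<eta> u z) \<partial>D)"
      unfolding R_def using potential_drift(1)[OF a Suc.prems] by (simp add: prob_space)
    also have "\<dots> \<le> a / 2 + 2 * real n / a -
        (potential a u + 2 * (1 - 2 * \<eta>) * \<gamma> * disagreement (halfspace u) - 2 / a)"
      using potential_drift(2)[OF a Suc.prems] by simp
    finally show "2 * (1 - 2 * \<eta>) * \<gamma> * disagreement (halfspace u) + (\<integral>z. R n (perceptron_step d \<eta> u z) \<partial>D) \<le> R (Suc n) u"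
      by (simp add: R_def add_divide_distrib distrib_left)
  qed
  finally show ?case
    by (simp add: \<Phi>_def \<phi>_def R_def)
qed

section \<open>Error of the majority vote\<close>

text \<open>Where the vote is wrong, at least half of the voters are wrong; integrate this pointwise
  bound.\<close>

lemma disagreement_vote_le:
  assumes n: "n > 0" and \<omega>: "\<omega> \<in> space S"
  shows "disagreement (vote d \<eta> n \<omega>) \<le>
    2 / real n * (\<Sum>t<n. disagreement (halfspace (weights d \<eta> (origin d) \<omega> t)))"
proof -
  note [measurable] = origin_in_space[of d] \<omega>
  let ?h = "\<lambda>t x. halfspace (weights d \<eta> (origin d) \<omega> t) x"
  have [measurable]: "weights d \<eta> (origin d) \<omega> t \<in> space (euclid d)" for t
    by (induction t) (simp_all add: origin_in_space perceptron_step_in_space)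
  have int: "integrable D (\<lambda>z. if ?h t (fst z) \<noteq> halfspace w (fst z) then 1 else 0 :: real)" for t
    by (intro integrable_const_bound[where B = 1]) auto
  have "disagreement (vote d \<eta> n \<omega>) \<le>
      (\<integral>z. 2 / real n * (\<Sum>t<n. if ?h t (fst z) \<noteq> halfspace w (fst z) then 1 else 0) \<partial>D)"
    unfolding disagreement_def
  proof (rule integral_mono)
    fix z
    have "real n \<le> 2 * (\<Sum>t<n. if ?h t (fst z) \<noteq> halfspace w (fst z) then 1 else 0)"
      if "vote d \<eta> n \<omega> (fst z) \<noteq> halfspace w (fst z)"
      using that sgn_pm_cases unfolding vote_def by (intro majority_error) auto
    then show "(if vote d \<eta> n \<omega> (fst z) \<noteq> halfspace w (fst z) then 1 else 0) \<le>
        2 / real n * (\<Sum>t<n. if ?h t (fst z) \<noteq> halfspace w (fst z) then 1 else 0)"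
      using n by (auto simp: field_simps sum_nonneg)
  next
    show "integrable D (\<lambda>z. if vote d \<eta> n \<omega> (fst z) \<noteq> halfspace w (fst z) then 1 else 0 :: real)"
      unfolding vote_def by (intro integrable_const_bound[where B = 1]) auto
  qed (use int in auto)
  also have "\<dots> = 2 / real n * (\<Sum>t<n. disagreement (?h t))"
    unfolding disagreement_def using int by simp
  finally show ?thesis .
qed

text \<open>Joint measurability is needed because the success event constrains the sample through a
  probability over points.\<close>

lemma vote_measurable:
  "(\<lambda>(\<omega>, x). vote d \<eta> n \<omega> x) \<in> borel_measurable (S \<Otimes>\<^sub>M euclid d)"
  unfolding vote_def using origin_in_space[of d] by measurable

lemma vote_measurable_labels:
  assumes [measurable]: "\<omega> \<in> space S"
  shows "vote d \<eta> n \<omega> \<in> euclid d \<rightarrow>\<^sub>M labels"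
proof -
  have [measurable]: "vote d \<eta> n \<omega> \<in> borel_measurable (euclid d)"
    using measurable_Pair2[OF vote_measurable assms] by simp
  have "vote d \<eta> n \<omega> -` {y} \<inter> space (euclid d) \<in> sets (euclid d)" for y
    by measurable
  then show ?thesis
    unfolding labels_def by (subst measurable_count_space_eq2) (auto simp: vote_def sgn_pm_def)
qed

lemma prob_vote_error:
  assumes \<epsilon>: "0 < \<epsilon>" and n: "n > 0" "400 \<le> real n * (\<gamma> * \<gamma> * (\<epsilon> * \<epsilon>))"
  shows "\<P>(\<omega> in S. \<P>((x, y) in D. vote d \<eta> n \<omega> x \<noteq> y) \<le> \<eta> + \<epsilon>) \<ge> 9 / 10"
proof -
  note [measurable] = vote_measurable origin_in_space[of d]
  define \<beta> where "\<beta> = 1 - 2 * \<eta>"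
  have \<beta>: "0 < \<beta>" using \<eta>_less by (simp add: \<beta>_def)
  define X where "X \<omega> = (\<Sum>t<n. 2 * \<beta> * \<gamma> * disagreement (halfspace (weights d \<eta> (origin d) \<omega> t)))" for \<omega>
  have [measurable]: "X \<in> borel_measurable S"
    unfolding X_def by measurable
  have X_nonneg: "0 \<le> X \<omega>" for \<omega>
    unfolding X_def using \<beta> \<gamma>_pos disagreement_nonneg by (intro sum_nonneg mult_nonneg_nonneg) auto
  have "(\<integral>\<^sup>+\<omega>. ennreal (X \<omega>) \<partial>S) \<le> ennreal (2 * sqrt n)"
  proof -
    \<comment> \<open>The choice a = 2 \<surd>n minimises a/2 + 2n/a; the potential at the origin is
      0.\<close>
    have "2 * sqrt n / 2 + 2 * real n / (2 * sqrt n) = 2 * sqrt n"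
      using n(1) real_div_sqrt[of "real n"] by simp
    then show ?thesis
      using expected_disagreement[of "2 * sqrt n" "origin d" n] n(1) origin_in_space \<beta> \<gamma>_pos disagreement_nonneg
      by (simp add: X_def \<beta>_def potential_def sum_ennreal mult_nonneg_nonneg)
  qed
  then have X_int: "integrable S X" and X_le: "(\<integral>\<omega>. X \<omega> \<partial>S) \<le> 2 * sqrt n"
  proof -
    assume *: "(\<integral>\<^sup>+\<omega>. ennreal (X \<omega>) \<partial>S) \<le> ennreal (2 * sqrt n)"
    then show int: "integrable S X"
      using X_nonneg by (intro integrableI_nonneg) (auto intro: le_less_trans)
    show "(\<integral>\<omega>. X \<omega> \<partial>S) \<le> 2 * sqrt n"
      using * X_nonneg by (simp add: nn_integral_eq_integral[OF int] )
  qed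
  \<comment> \<open>The Markov threshold: the excess error is at most
    \<open>X \<omega> / (real n * \<gamma>)\<close>, which is below \<epsilon> once
    \<open>X \<omega> < b\<close>.\<close>
  define b where "b = real n * \<gamma> * \<epsilon>"
  have b: "b > 0"
    using n(1) \<gamma>_pos \<epsilon> by (simp add: b_def)
  have "seq.P.prob {\<omega> \<in> space S. b \<le> X \<omega>} \<le> 1 / b * (\<integral>\<omega>. X \<omega> \<partial>S)"
    using integral_Markov_inequality_measure[OF X_int, of "{}" b] X_nonneg b by simp
  also have "\<dots> \<le> 1 / b * (2 * sqrt n)"
    using X_le b by (intro mult_left_mono) auto
  also have "\<dots> \<le> 1 / 10"
  proof -
    \<comment> \<open>After squaring, this is the assumption on \<open>n\<close> multiplied by
      \<open>n\<close>; the 20 becomes 1/10 against the mean bound 2 \<surd>n.\<close>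
    have "20 * sqrt n \<le> b"
    proof (rule power2_le_imp_le)
      have "400 * real n \<le> real n * (\<gamma> * \<gamma> * (\<epsilon> * \<epsilon>)) * real n"
        using n by (intro mult_right_mono) auto
      then show "(20 * sqrt n)\<^sup>2 \<le> b\<^sup>2"
        by (simp add: power_mult_distrib) (simp add: b_def power2_eq_square algebra_simps)
    qed (use b in simp)
    then show ?thesis
      using b by (simp add: field_simps)
  qed
  finally have bad: "seq.P.prob {\<omega> \<in> space S. b \<le> X \<omega>} \<le> 1 / 10" .
  have err: "\<P>((x, y) in D. vote d \<eta> n \<omega> x \<noteq> y) = \<eta> + \<beta> * disagreement (vote d \<eta> n \<omega>)"
    if "\<omega> \<in> space S" for \<omega>
    unfolding \<beta>_def using measurable_Pair2[OF vote_measurable that] sgn_pm_cases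
    by (intro misclassification_eq) (auto simp: vote_def)
  have good: "\<P>((x, y) in D. vote d \<eta> n \<omega> x \<noteq> y) \<le> \<eta> + \<epsilon>" if "\<omega> \<in> space S" "\<not> b \<le> X \<omega>" for \<omega>
  proof -
    have "\<beta> * disagreement (vote d \<eta> n \<omega>) \<le>
        \<beta> * (2 / real n * (\<Sum>t<n. disagreement (halfspace (weights d \<eta> (origin d) \<omega> t))))"
      using disagreement_vote_le[OF n(1) that(1)] \<beta> by (intro mult_left_mono) auto
    also have "\<dots> = X \<omega> / (real n * \<gamma>)"
      unfolding X_def sum_distrib_left[symmetric] using \<gamma>_pos n(1) by (simp add: field_simps)
    also have "\<dots> \<le> \<epsilon>"
      using that(2) \<gamma>_pos n(1) by (simp add: b_def pos_divide_le_eq algebra_simps)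
    finally show ?thesis
      using err[OF that(1)] by simp
  qed
  \<comment> \<open>Monotonicity of the measure requires the success event to be measurable, which
    is visible once the error is expressed by \<open>disagreement\<close>.\<close>
  have "{\<omega> \<in> space S. \<P>((x, y) in D. vote d \<eta> n \<omega> x \<noteq> y) \<le> \<eta> + \<epsilon>} =
      {\<omega> \<in> space S. \<eta> + \<beta> * disagreement (vote d \<eta> n \<omega>) \<le> \<eta> + \<epsilon>}"
    using err by auto
  also have "\<dots> \<in> sets S"
    by measurable
  finally have "seq.P.prob (space S - {\<omega> \<in> space S. b \<le> X \<omega>}) \<le>
      seq.P.prob {\<omega> \<in> space S. \<P>((x, y) in D. vote d \<eta> n \<omega> x \<noteq> y) \<le> \<eta> + \<epsilon>}"
    using good by (intro seq.P.finite_measure_mono) auto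
  moreover have "seq.P.prob (space S - {\<omega> \<in> space S. b \<le> X \<omega>}) = 1 - seq.P.prob {\<omega> \<in> space S. b \<le> X \<omega>}"
    by (rule seq.P.prob_compl) measurable
  ultimately show ?thesis
    using bad by simp
qed

end

section \<open>Sample complexity and the combined guarantee\<close>

text \<open>The ceiling adds at most 1, which is absorbed since \<gamma> and \<epsilon> are below 1
  whenever anything is drawn. The logarithm gets exponent 0.\<close>

lemma soft_O_sample_size:
  "soft_O_on params (\<lambda>p. real (case p of (\<epsilon>, \<gamma>, \<eta>, d) \<Rightarrow> sample_size \<epsilon> \<gamma>))
     (\<lambda>(\<epsilon>, \<gamma>, \<eta>, d). 1 / (\<gamma>\<^sup>2 * \<epsilon>\<^sup>2))"
proof -
  have "real (sample_size \<epsilon> \<gamma>) \<le> 401 * (1 / (\<gamma>\<^sup>2 * \<epsilon>\<^sup>2))"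
    if "0 < \<epsilon>" "0 < \<gamma>" "\<gamma> < 1" for \<epsilon> \<gamma> :: real
  proof (cases "\<epsilon> < 1")
    case True
    have "\<gamma>\<^sup>2 * \<epsilon>\<^sup>2 \<le> 1"
      using that True by (intro mult_le_one) (auto simp: power_le_one)
    then have "1 \<le> 1 / (\<gamma>\<^sup>2 * \<epsilon>\<^sup>2)"
      using that by simp
    moreover have "real (sample_size \<epsilon> \<gamma>) \<le> 400 / (\<gamma>\<^sup>2 * \<epsilon>\<^sup>2) + 1"
      using True of_int_ceiling_le_add_one[of "400 / (\<gamma>\<^sup>2 * \<epsilon>\<^sup>2)"] that
      by (simp add: sample_size_def of_nat_nat)
    ultimately show ?thesis
      by simp
  qed (simp add: sample_size_def)
  then show ?thesis
    unfolding soft_O_on_def by (intro exI[of _ 401] exI[of _ 0]) (auto simp: params_def)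
qed

theorem theorem1p2:
  "\<exists>(L :: com) (E :: com) (N :: real \<times> real \<times> real \<times> nat \<Rightarrow> nat) (c :: nat) (k :: nat).
     draw_free E \<and>
     soft_O_on params (\<lambda>p. real (N p)) (\<lambda>(\<epsilon>, \<gamma>, \<eta>, d). 1 / (\<gamma>\<^sup>2 * \<epsilon>\<^sup>2)) \<and>
     (\<forall>(\<epsilon>, \<gamma>, \<eta>, d) \<in> params. \<forall>D. rcn_margin_halfspace d \<gamma> \<eta> D \<longrightarrow>
        (\<exists>h :: (nat \<Rightarrow> example) \<Rightarrow> point \<Rightarrow> real.
           (\<forall>\<omega> \<in> space (\<Pi>\<^sub>M i\<in>(UNIV :: nat set). D).
              h \<omega> \<in> euclid d \<rightarrow>\<^sub>M labels \<and>
              (\<exists>t s. runs d \<omega> L (learner_input d \<epsilon> \<gamma> \<eta>) t s \<and>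
                 drawn s = N (\<epsilon>, \<gamma>, \<eta>, d) \<and>
                 t \<le> c * (N (\<epsilon>, \<gamma>, \<eta>, d) + d) ^ k \<and>
                 represents_within d \<omega> E s (c * (N (\<epsilon>, \<gamma>, \<eta>, d) + d) ^ k) (h \<omega>))) \<and>
           \<P>(\<omega> in (\<Pi>\<^sub>M i\<in>(UNIV :: nat set). D). \<P>((x, y) in D. h \<omega> x \<noteq> y) \<le> \<eta> + \<epsilon>) \<ge> 9 / 10))"
proof -
  define N :: "real \<times> real \<times> real \<times> nat \<Rightarrow> nat" where "N = (\<lambda>(\<epsilon>, \<gamma>, \<eta>, d). sample_size \<epsilon> \<gamma>)"
  have soft_O: "soft_O_on params (\<lambda>p. real (N p)) (\<lambda>(\<epsilon>, \<gamma>, \<eta>, d). 1 / (\<gamma>\<^sup>2 * \<epsilon>\<^sup>2))"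
    using soft_O_sample_size unfolding N_def .
  have main: "\<exists>h :: (nat \<Rightarrow> example) \<Rightarrow> point \<Rightarrow> real.
           (\<forall>\<omega> \<in> space (\<Pi>\<^sub>M i\<in>(UNIV :: nat set). D).
              h \<omega> \<in> euclid d \<rightarrow>\<^sub>M labels \<and>
              (\<exists>t s. runs d \<omega> learner (learner_input d \<epsilon> \<gamma> \<eta>) t s \<and>
                 drawn s = N (\<epsilon>, \<gamma>, \<eta>, d) \<and>
                 t \<le> 400 * (N (\<epsilon>, \<gamma>, \<eta>, d) + d) ^ 2 \<and>
                 represents_within d \<omega> evaluator s (400 * (N (\<epsilon>, \<gamma>, \<eta>, d) + d) ^ 2) (h \<omega>))) \<and>
           \<P>(\<omega> in (\<Pi>\<^sub>M i\<in>(UNIV :: nat set). D). \<P>((x, y) in D. h \<omega> x \<noteq> y) \<le> \<eta> + \<epsilon>) \<ge> 9 / 10"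
    if p: "0 < \<epsilon>" "0 < \<gamma>" "\<gamma> < 1" "0 < \<eta>" "\<eta> < 1/2" "1 \<le> d" and D: "rcn_margin_halfspace d \<gamma> \<eta> D"
    for \<epsilon> \<gamma> \<eta> :: real and d :: nat and D
  proof -
    obtain w where "rcn_halfspace D d \<gamma> \<eta> w"
      using p D unfolding rcn_margin_halfspace_def rcn_halfspace_def rcn_halfspace_axioms_def by blast
    then interpret rcn_halfspace D d \<gamma> \<eta> w .
    define n where "n = sample_size \<epsilon> \<gamma>"
    have time: "n * (100 * d + 250) + 50 \<le> 400 * (n + d)\<^sup>2" "n * (30 * d + 100) + 100 \<le> 400 * (n + d)\<^sup>2"
    proof -
      define q m k where "q = n * n" and "m = n * d" and "k = d * d"
      have sq: "(n + d)\<^sup>2 = q + 2 * m + k"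
        by (simp add: q_def m_def k_def power2_eq_square algebra_simps)
      have lin: "n * (100 * d + 250) = 100 * m + 250 * n" "n * (30 * d + 100) = 30 * m + 100 * n"
        by (simp_all add: m_def algebra_simps)
      \<comment> \<open>From \<open>1 \<le> d\<close>, the terms linear in \<open>n\<close> and the
        constants are dominated by the quadratic ones; with the products named, the rest is linear
        arithmetic.\<close>
      have "n \<le> m" "1 \<le> k"
        using p(6) by (auto simp: m_def k_def)
      then show "n * (100 * d + 250) + 50 \<le> 400 * (n + d)\<^sup>2" "n * (30 * d + 100) + 100 \<le> 400 * (n + d)\<^sup>2"
        unfolding sq lin by simp_all
    qed
    have exec: "\<exists>t s. runs d \<omega> learner (learner_input d \<epsilon> \<gamma> \<eta>) t s \<and> drawn s = n \<and>
        t \<le> 400 * (n + d)\<^sup>2 \<and> represents_within d \<omega> evaluator s (400 * (n + d)\<^sup>2) (vote d \<eta> n \<omega>)" for \<omega>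
    proof -
      obtain t s where run: "runs d \<omega> learner (learner_input d \<epsilon> \<gamma> \<eta>) t s"
          "t \<le> n * (100 * d + 250) + 50" and inv: "round_inv d \<omega> \<epsilon> \<gamma> \<eta> n s"
        using runs_within_learner[OF p(1,2)] unfolding runs_within_def n_def by blast
      have "represents_within d \<omega> evaluator s (400 * (n + d)\<^sup>2) (vote d \<eta> n \<omega>)"
        unfolding represents_within_def
      proof
        fix x
        have "runs_within d \<omega> evaluator (load_query d x s) (400 * (n + d)\<^sup>2)
            (\<lambda>s'. cell s' 0 0 = vote d \<eta> n \<omega> x)"
          by (rule runs_within_mono[OF runs_within_evaluator[OF inv] time(2)])
        then show "\<exists>t s'. runs d \<omega> evaluator (load_query d x s) t s' \<and> t \<le> 400 * (n + d)\<^sup>2 \<and>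
            cell s' 0 0 = vote d \<eta> n \<omega> x"
          unfolding runs_within_def .
      qed
      then show ?thesis
        using run inv time(1) by (intro exI[of _ t] exI[of _ s]) (auto simp: round_inv_def)
    qed
    have "\<P>(\<omega> in S. \<P>((x, y) in D. vote d \<eta> n \<omega> x \<noteq> y) \<le> \<eta> + \<epsilon>) \<ge> 9 / 10"
    proof (cases "\<epsilon> < 1")
      case True
      then have "0 < n" "400 \<le> real n * (\<gamma> * \<gamma> * (\<epsilon> * \<epsilon>))"
        using less_sample_size_iff[OF p(1,2) True, of 0] less_sample_size_iff[OF p(1,2) True, of n]
        by (auto simp: n_def)
      then show ?thesis
        by (rule prob_vote_error[OF p(1)])
    next
      case False
      \<comment> \<open>With \<epsilon> at least 1 the error bound exceeds every
        probability.\<close>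
      then have "{\<omega> \<in> space S. \<P>((x, y) in D. vote d \<eta> n \<omega> x \<noteq> y) \<le> \<eta> + \<epsilon>} = space S"
        using p(4) by (auto intro: order.trans[OF prob_le_1])
      then show ?thesis
        by (simp add: seq.P.prob_space)
    qed
    then show ?thesis
      using exec vote_measurable_labels by (intro exI[of _ "vote d \<eta> n"]) (auto simp: N_def n_def)
  qed
  show ?thesis
    apply (rule exI[of _ learner], rule exI[of _ evaluator], rule exI[of _ N],
        rule exI[of _ 400], rule exI[of _ 2], intro conjI ballI)
      apply (rule draw_free_evaluator)
     apply (rule soft_O)
    subgoal for p
      by (cases p rule: prod_cases4)
        (simp only: prod.case params_def mem_Collect_eq, intro allI impI, elim conjE, rule main)
    done
qed

end
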